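(* Let $\varepsilon\in\{-2,-1,1,2\}$ and let $A,K$ be integers satisfying $K\ge 30.03|\varepsilon|^3(A+1)$ with either $A\ge 3$ or $A=|\varepsilon|=2$. Put $N=(A^2+A)K/2+\varepsilon A$. Then the numbers $\theta_1=\sqrt{1-\varepsilon A/N}$ and $\theta_2=\sqrt{1+\varepsilon/N}$ satisfy \[ \max\left\{\left|\theta_1-\frac{p_1}{q}\right|,\left|\theta_2-\frac{p_2}{q}\right|\right\}>\left(2.838\cdot 10^{28}(A+1)N\right)^{-1}q^{-\lambda} \] for all integers $p_1,p_2,q$ with $q>0$, where \[ \lambda=1+\frac{\log(20(A+1)N)}{\log\left(\frac{1.338N^2}{|\varepsilon|^3A(A+1)}\right)}<2. \] *)

theory Defs imports Complex_Main begin

end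

theory Submission imports Defs "HOL-Analysis.Analysis" begin

text \<open>Put \<open>x = \<epsilon>/N\<close> and take the nodes \<open>a = (-A, 0, 1)\<close>, so that the numbers to approximate are
  \<open>\<surd>(1 + a\<^sub>j x)\<close>. The divided difference of \<open>(1 + x z)\<^bsup>k + 1/2\<^esup>\<close> with every node taken \<open>k\<close> times,
  one of them \<open>k + 1\<close> times, is a linear form in these square roots with coefficients rational in \<open>x\<close>
  (Rickert's form of the Hermite--Pade approximants); here divided differences are sums of local
  residues, that is, of coefficients of power series. The form has size about
  \<open>(4/27)\<^bsup>k\<^esup> |x|\<^bsup>3k\<^esup>\<close>, and because \<open>2 (N + a\<^sub>j \<epsilon>)\<close> is a multiple of the product of the differences
  \<open>a\<^sub>j - a\<^sub>l\<close>, the factor \<open>(4 N A (A + 1))\<^bsup>k\<^esup>\<close> already clears all denominators.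

  This gives approximations with the growth rates \<open>P' = 21.5 (A + 1) N\<close> and
  \<open>L' = 1.6 N\<^sup>2 / (|\<epsilon>|\<^sup>3 A (A + 1))\<close>. Compared with the rates \<open>P\<close>, \<open>L\<close> of the statement,
  \<open>(P'/P)\<^sup>2 \<le> L'/L\<close> and \<open>L \<le> P\<^sup>2\<close>, whence \<open>ln P' / ln L' \<le> ln P / ln L\<close>; thus no gain from common prime
  factors of the coefficients is needed.\<close>

section \<open>Linear algebra: independent rows of a square matrix\<close>

lemma rows_independent_imp_kernel_trivial:
  fixes P :: "'n::finite \<Rightarrow> 'n \<Rightarrow> real"
  assumes "\<And>c. (\<And>j. (\<Sum>i\<in>UNIV. c i * P i j) = 0) \<Longrightarrow> \<forall>i. c i = 0"
    and "\<And>i. (\<Sum>j\<in>UNIV. P i j * v j) = 0"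
  shows "v j = 0"
proof -
  define M :: "real ^ 'n ^ 'n" where "M = (\<chi> i j. P i j)"
  have "x = 0" if "transpose M *v x = 0" for x
  proof -
    have "(\<Sum>i\<in>UNIV. x $ i * P i j) = (transpose M *v x) $ j" for j
      by (simp add: matrix_vector_mult_def transpose_def M_def mult.commute)
    with that have "\<forall>i. x $ i = 0"
      by (intro assms(1)) simp
    then show ?thesis
      by (simp add: vec_eq_iff)
  qed
  \<comment> \<open>A trivial kernel gives the transpose a left inverse, hence \<open>M\<close> a
    right inverse, which for a square matrix is also a left inverse.\<close>
  then obtain B where B: "B ** transpose M = mat 1"
    using matrix_left_invertible_ker[of "transpose M"] by blast
  then have "M ** transpose B = mat 1"
    by (metis matrix_transpose_mul transpose_mat transpose_transpose)
  then have "transpose B ** M = mat 1"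
    by (simp only: matrix_left_right_inverse)
  then have "\<forall>x. M *v x = 0 \<longrightarrow> x = 0"
    using matrix_left_invertible_ker by blast
  moreover have "M *v (\<chi> j. v j) = 0"
    using assms(2) by (simp add: matrix_vector_mult_def M_def vec_eq_iff)
  ultimately have "(\<chi> j. v j) = (0 :: real ^ 'n)"
    by blast
  then show ?thesis
    by (metis vec_lambda_beta zero_index)
qed

section \<open>Divided differences and the size of the linear forms\<close>

unbundle no vec_syntax
unbundle fps_syntax

text \<open>With \<open>fps_X\<close> standing for z - a_j, this is the expansion at a_j of the
  product of (z - a_l)^(-n_l) over l \<noteq> j.\<close>

definition local_cofactor :: "('n::finite \<Rightarrow> real) \<Rightarrow> ('n \<Rightarrow> nat) \<Rightarrow> 'n \<Rightarrow> real fps" where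
  "local_cofactor a n j = (\<Prod>l\<in>-{j}. inverse (fps_const (a j - a l) + fps_X) ^ n l)"

text \<open>The residue at a_j of f(z) divided by the product of all (z - a_l)^(n_l). Order 0 is
  treated separately because \<open>n j - 1\<close> would truncate to 0 and read off a constant
  coefficient.\<close>

definition local_residue :: "('n::finite \<Rightarrow> real) \<Rightarrow> ('n \<Rightarrow> nat) \<Rightarrow> 'n \<Rightarrow> real fps \<Rightarrow> real" where
  "local_residue a n j f = (if n j = 0 then 0 else (f * local_cofactor a n j) $ (n j - 1))"

text \<open>The divided difference of z^h at the nodes with multiplicities \<open>n\<close>, that
  is, a complete homogeneous symmetric polynomial in the nodes.\<close>

definition residue_moment :: "('n::finite \<Rightarrow> real) \<Rightarrow> ('n \<Rightarrow> nat) \<Rightarrow> nat \<Rightarrow> real" where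
  "residue_moment a n h = (\<Sum>j\<in>UNIV. local_residue a n j ((fps_const (a j) + fps_X) ^ h))"

lemma fps_linear_power_nth:
  "((fps_const a + fps_X) ^ h) $ s = of_nat (h choose s) * (a :: real) ^ (h - s)"
proof (induction h arbitrary: s)
  case (Suc h)
  show ?case
  proof (cases s)
    case (Suc s')
    have "a * (of_nat (h choose Suc s') * a ^ (h - Suc s')) = of_nat (h choose Suc s') * a ^ (h - s')"
      by (cases "s' < h") (simp_all add: Suc_diff_Suc flip: power_Suc)
    with Suc show ?thesis
      by (simp add: Suc.IH distrib_right)
  qed (simp add: Suc.IH distrib_right)
qed simp

lemma local_residue_add:
  "local_residue a n j (f + g) = local_residue a n j f + local_residue a n j g"
  by (simp add: local_residue_def distrib_right)

lemma local_residue_cmult: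
  "local_residue a n j (fps_const c * f) = c * local_residue a n j f"
  by (simp add: local_residue_def mult.assoc)

lemma local_residue_eq_sum:
  "local_residue a n j f = (\<Sum>s<n j. f $ s * local_cofactor a n j $ (n j - 1 - s))"
proof (cases "n j")
  case (Suc m)
  then have "{..<n j} = {0..m}"
    by auto
  with Suc show ?thesis
    by (simp add: local_residue_def fps_mult_nth)
qed (simp add: local_residue_def)

text \<open>The factor z - a_l cancels one power in the denominator: for j = l it shifts the
  coefficient index, otherwise it removes one inverse from the cofactor.\<close>

lemma local_residue_mult_linear:
  assumes "inj a" and "n l > 0"
  shows "local_residue a n j ((fps_const (a j - a l) + fps_X) * f)
           = local_residue a (n(l := n l - 1)) j f"
proof (cases "j = l")
  case True
  have "local_cofactor a (n(l := n l - 1)) l = local_cofactor a n l"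
    unfolding local_cofactor_def by (intro prod.cong) auto
  then show ?thesis
    using True assms by (auto simp: local_residue_def mult.assoc)
next
  case False
  obtain m where m: "n l = Suc m"
    using assms gr0_implies_Suc by blast
  have nz: "a j - a l \<noteq> 0"
    using assms False by (auto dest: injD)
  have l: "l \<in> - {j}"
    using False by auto
  have "local_cofactor a n j = inverse (fps_const (a j - a l) + fps_X) ^ n l *
        (\<Prod>i\<in>-{j}-{l}. inverse (fps_const (a j - a i) + fps_X) ^ n i)"
    unfolding local_cofactor_def using l by (subst prod.remove[of _ l]) auto
  moreover have "local_cofactor a (n(l := n l - 1)) j = inverse (fps_const (a j - a l) + fps_X) ^ m *
        (\<Prod>i\<in>-{j}-{l}. inverse (fps_const (a j - a i) + fps_X) ^ n i)"
    unfolding local_cofactor_def using l m by (subst prod.remove[of _ l]) auto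
  ultimately have "local_cofactor a n j
      = inverse (fps_const (a j - a l) + fps_X) * local_cofactor a (n(l := n l - 1)) j"
    using m by (simp add: mult.assoc)
  moreover have "(fps_const (a j - a l) + fps_X) * inverse (fps_const (a j - a l) + fps_X) = 1"
    using nz by (intro inverse_mult_eq_1') simp
  ultimately have "(fps_const (a j - a l) + fps_X) * f * local_cofactor a n j
      = f * local_cofactor a (n(l := n l - 1)) j"
    by (smt (verit) mult.assoc mult.commute mult.left_commute mult_1)
  moreover have "(n(l := n l - 1)) j = n j"
    using False by simp
  ultimately show ?thesis
    unfolding local_residue_def by presburger
qed

text \<open>Splits z^(h + 1) as a_l z^h + (z - a_l) z^h. Any node of positive order may serve as
  \<open>l\<close>, a freedom that determines the zeroth moment below.\<close>

lemma residue_moment_Suc: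
  assumes "inj a" and "n l > 0"
  shows "residue_moment a n (Suc h)
           = a l * residue_moment a n h + residue_moment a (n(l := n l - 1)) h"
proof -
  have "local_residue a n j ((fps_const (a j) + fps_X) ^ Suc h)
      = a l * local_residue a n j ((fps_const (a j) + fps_X) ^ h)
        + local_residue a (n(l := n l - 1)) j ((fps_const (a j) + fps_X) ^ h)" for j
  proof -
    let ?z = "(fps_const (a j) + fps_X) ^ h"
    have "(fps_const (a j) + fps_X) ^ Suc h
        = fps_const (a l) * ?z + (fps_const (a j - a l) + fps_X) * ?z"
      by (simp add: algebra_simps flip: fps_const_sub)
    then show ?thesis
      by (simp only: local_residue_add local_residue_cmult local_residue_mult_linear[of a n l, OF assms])
  qed
  then show ?thesis
    by (simp add: residue_moment_def sum.distrib sum_distrib_left)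
qed

lemma sum_fun_upd_pred:
  fixes n :: "'n::finite \<Rightarrow> nat"
  assumes "n l > 0"
  shows "sum (n(l := n l - 1)) UNIV = sum n UNIV - 1"
proof -
  have "sum n UNIV = n l + sum n (UNIV - {l})"
    by (simp add: sum.remove[of UNIV l])
  moreover have "sum (n(l := n l - 1)) UNIV = (n l - 1) + sum (n(l := n l - 1)) (UNIV - {l})"
    by (subst sum.remove[of UNIV l]) simp_all
  moreover have "sum (n(l := n l - 1)) (UNIV - {l}) = sum n (UNIV - {l})"
    by (intro sum.cong) auto
  ultimately show ?thesis
    using assms by simp
qed

text \<open>The residues of a function that is O(z^-2) at infinity sum to 0. With two distinct
  nodes, computing the first moment through each of them and comparing forces the zeroth moment to
  vanish.\<close>

lemma residue_moment_0:
  fixes a :: "'n::finite \<Rightarrow> real"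
  assumes "inj a" and "sum n UNIV > 0"
  shows "residue_moment a n 0 = (if sum n UNIV = 1 then 1 else 0)"
  using assms(2)
proof (induction "sum n UNIV" arbitrary: n rule: less_induct)
  case less
  from less.prems obtain l where l: "n l > 0"
    by (metis sum.neutral neq0_conv)
  show ?case
  proof (cases "\<exists>l'. l' \<noteq> l \<and> n l' > 0")
    case True
    then obtain l' where l': "l' \<noteq> l" "n l' > 0"
      by blast
    have "n l + n l' = sum n {l, l'}"
      using l'(1) by simp
    also have "\<dots> \<le> sum n UNIV"
      by (intro sum_mono2) auto
    finally have ge2: "sum n UNIV \<ge> 2"
      using l l' by simp
    \<comment> \<open>By induction the moment for the reduced orders depends only on their total, so
      the last summand is the same for every \<open>i\<close>.\<close>
    have step: "residue_moment a n (Suc 0) = a i * residue_moment a n 0 + (if sum n UNIV = 2 then 1 else 0)"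
      if i: "n i > 0" for i
    proof -
      have "sum (n(i := n i - 1)) UNIV < sum n UNIV" "sum (n(i := n i - 1)) UNIV > 0"
        unfolding sum_fun_upd_pred[of n i, OF i] using ge2 by linarith+
      from less.hyps[OF this] show ?thesis
        unfolding residue_moment_Suc[of a n i 0, OF assms(1) i] sum_fun_upd_pred[of n i, OF i]
        using ge2 by (simp split: if_splits)
    qed
    have "a l * residue_moment a n 0 = a l' * residue_moment a n 0"
      using step[OF l] step[OF l'(2)] by linarith
    moreover have "a l \<noteq> a l'"
      using assms(1) l'(1) by (auto dest: injD)
    ultimately have "residue_moment a n 0 = 0"
      by (metis mult_cancel_right)
    moreover have "sum n UNIV \<noteq> 1"
      using ge2 by linarith
    ultimately show ?thesis
      by presburger
  next
    case False
    then have z: "n i = 0" if "i \<noteq> l" for i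
      using that gr0I by metis
    have sn: "sum n UNIV = n l"
      using z by (subst sum.remove[of _ l]) auto
    have "local_cofactor a n l = 1"
      unfolding local_cofactor_def using z by (intro prod.neutral) auto
    then have "local_residue a n i 1 = (if i = l then (if n l = 1 then 1 else 0) else 0)" for i
      using z l by (auto simp: local_residue_def)
    then show ?thesis
      using sn by (simp add: residue_moment_def)
  qed
qed

lemma residue_moment_no_nodes:
  fixes n :: "'n::finite \<Rightarrow> nat"
  assumes "sum n UNIV = 0"
  shows "residue_moment a n h = 0"
  using assms by (simp add: residue_moment_def local_residue_def)

text \<open>The moment is a sum of \<open>h choose t\<close> monomials of degree h - t in the nodes;
  Pascal's rule carries the induction. For h < t the bound is 0, which is the source of the factor
  |x|^t in the linear forms.\<close>

lemma residue_moment_bound: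
  fixes a :: "'n::finite \<Rightarrow> real"
  assumes "inj a" and M: "\<And>l. \<bar>a l\<bar> \<le> M" and "sum n UNIV = Suc t"
  shows "\<bar>residue_moment a n h\<bar> \<le> real (h choose t) * M ^ (h - t)"
  using assms(3)
proof (induction h arbitrary: n t)
  case 0
  then show ?case
    using residue_moment_0[OF assms(1), of n] by auto
next
  case (Suc h)
  have "M \<ge> 0"
    using M[of undefined] by linarith
  obtain l where l: "n l > 0"
    using Suc.prems by (metis sum.neutral neq0_conv nat.distinct(1))
  let ?n = "n(l := n l - 1)"
  have "\<bar>residue_moment a n (Suc h)\<bar> \<le> M * \<bar>residue_moment a n h\<bar> + \<bar>residue_moment a ?n h\<bar>"
    unfolding residue_moment_Suc[of a n l, OF assms(1) l]
    using mult_right_mono[OF M[of l], of "\<bar>residue_moment a n h\<bar>"]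
    by (simp flip: abs_mult)
  also have "M * \<bar>residue_moment a n h\<bar> \<le> M * (real (h choose t) * M ^ (h - t))"
    using Suc.IH[OF Suc.prems] \<open>M \<ge> 0\<close> by (rule mult_left_mono)
  also have "\<dots> = real (h choose t) * M ^ (Suc h - t)"
    by (cases "t \<le> h") (simp_all add: Suc_diff_le)
  finally have *: "\<bar>residue_moment a n (Suc h)\<bar>
      \<le> real (h choose t) * M ^ (Suc h - t) + \<bar>residue_moment a ?n h\<bar>"
    by (simp add: fun_upd_def)
  show ?case
  proof (cases t)
    case 0
    have "sum ?n UNIV = 0"
      unfolding sum_fun_upd_pred[of n l, OF l] using Suc.prems 0 by (simp only: diff_Suc_1)
    then have "residue_moment a ?n h = 0"
      by (rule residue_moment_no_nodes)
    with * 0 show ?thesis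
      by simp
  next
    case (Suc t')
    have "sum ?n UNIV = Suc t'"
      unfolding sum_fun_upd_pred[of n l, OF l] using Suc.prems Suc by (simp only: diff_Suc_1)
    from Suc.IH[OF this] have "\<bar>residue_moment a ?n h\<bar> \<le> real (h choose t') * M ^ (Suc h - t)"
      unfolding \<open>t = Suc t'\<close> diff_Suc_Suc .
    with * have "\<bar>residue_moment a n (Suc h)\<bar>
        \<le> real (h choose t) * M ^ (Suc h - t) + real (h choose t') * M ^ (Suc h - t)"
      by linarith
    also have "\<dots> = real (Suc h choose t) * M ^ (Suc h - t)"
      unfolding \<open>t = Suc t'\<close> by (simp add: distrib_right)
    finally show ?thesis .
  qed
qed

section \<open>Power series expansion and size of the linear forms\<close>

text \<open>The expansion of \<open>(c + x t)\<^bsup>k + 1/2\<^esup> / c\<^bsup>1/2\<^esup>\<close> in powers of \<open>t\<close>.\<close>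

definition root_germ :: "nat \<Rightarrow> real \<Rightarrow> real \<Rightarrow> real fps" where
  "root_germ k c x = Abs_fps (\<lambda>s. c ^ k * ((real k + 1/2) gchoose s) * (x / c) ^ s)"

text \<open>Rewrites (\<alpha> choose h)(h choose s) as (\<alpha> choose s)(\<alpha> - s choose h -
  s); with h = m + s the sum over m is the binomial series of (1 + a x)^(\<alpha> - s).\<close>

lemma root_germ_sums:
  fixes a x :: real and k :: nat
  defines "\<alpha> \<equiv> real k + 1/2"
  assumes "\<bar>a * x\<bar> < 1"
  shows "(\<lambda>h. (\<alpha> gchoose h) * x ^ h * ((fps_const a + fps_X) ^ h) $ s)
           sums (sqrt (1 + a * x) * root_germ k (1 + a * x) x $ s)"
proof -
  define c where "c = 1 + a * x"
  have c: "c > 0"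
    using assms by (simp add: c_def)
  let ?f = "\<lambda>h. (\<alpha> gchoose h) * x ^ h * ((fps_const a + fps_X) ^ h) $ s"
  have "(\<lambda>m. (\<alpha> gchoose s) * x ^ s * (((\<alpha> - real s) gchoose m) * (a * x) ^ m))
          sums ((\<alpha> gchoose s) * x ^ s * c powr (\<alpha> - real s))"
    unfolding c_def by (intro sums_mult gen_binomial_real assms)
  moreover have "?f (m + s) = (\<alpha> gchoose s) * x ^ s * (((\<alpha> - real s) gchoose m) * (a * x) ^ m)" for m
    using gbinomial_trinomial_revision[of s "m + s" \<alpha>]
    unfolding fps_linear_power_nth
    by (simp add: power_add power_mult_distrib binomial_gbinomial)
  moreover have "(\<alpha> gchoose s) * x ^ s * c powr (\<alpha> - real s) = sqrt c * root_germ k c x $ s"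
    using c by (simp add: root_germ_def \<alpha>_def powr_diff powr_add powr_realpow powr_half_sqrt
                    power_divide)
  ultimately have "(\<lambda>m. ?f (m + s)) sums (sqrt c * root_germ k c x $ s)"
    by simp
  moreover have "?f h = 0" if "h < s" for h
    using that by (simp add: fps_linear_power_nth)
  ultimately show ?thesis
    unfolding c_def by (subst (asm) sums_zero_iff_shift) auto
qed

text \<open>Expanding (1 + x z)^(k + 1/2) in powers of z under the residues turns the form in the
  square roots into a series in the moments.\<close>

lemma linear_form_sums:
  fixes a :: "'n::finite \<Rightarrow> real"
  assumes "\<And>j. \<bar>a j * x\<bar> < 1"
  shows "(\<lambda>h. ((real k + 1/2) gchoose h) * x ^ h * residue_moment a n h)
           sums (\<Sum>j\<in>UNIV. sqrt (1 + a j * x) * local_residue a n j (root_germ k (1 + a j * x) x))"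
proof -
  have "(\<lambda>h. \<Sum>s<n j. ((real k + 1/2) gchoose h) * x ^ h * ((fps_const (a j) + fps_X) ^ h) $ s
              * local_cofactor a n j $ (n j - 1 - s))
        sums (\<Sum>s<n j. sqrt (1 + a j * x) * root_germ k (1 + a j * x) x $ s
              * local_cofactor a n j $ (n j - 1 - s))" for j
    by (intro sums_sum sums_mult2 root_germ_sums assms)
  then show ?thesis
    unfolding residue_moment_def sum_distrib_left local_residue_eq_sum mult.assoc
    by (intro sums_sum[of UNIV]) blast
qed

lemma abs_gbinomial_nonpos:
  assumes "b \<le> (0::real)"
  shows "\<bar>b gchoose m\<bar> = (-1) ^ m * (b gchoose m)"
proof (induction m)
  case (Suc m)
  have "(b gchoose Suc m) = (b gchoose m) * ((b - m) / Suc m)"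
    using gbinomial_mult_1[of b m] by (simp add: field_simps)
  moreover have "\<bar>(b - m) / Suc m\<bar> = - ((b - m) / Suc m)"
    using assms by (intro abs_of_nonpos) (simp add: divide_nonpos_pos)
  ultimately show ?case
    using Suc.IH by (simp only: abs_mult) simp
qed simp

text \<open>Terms of index below t vanish with their moments. The others are dominated by a multiple
  of the binomial series of (1 - M|x|)^(\<alpha> - t), whose terms are nonnegative because \<alpha>
  \<le> t.\<close>

lemma linear_form_bound:
  fixes a :: "'n::finite \<Rightarrow> real"
  assumes "inj a" and M: "\<And>l. \<bar>a l\<bar> \<le> M" and "M * \<bar>x\<bar> < 1"
    and "sum n UNIV = Suc t" and "real k + 1/2 \<le> real t"
  shows "\<bar>\<Sum>j\<in>UNIV. sqrt (1 + a j * x) * local_residue a n j (root_germ k (1 + a j * x) x)\<bar>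
           \<le> \<bar>(real k + 1/2) gchoose t\<bar> * \<bar>x\<bar> ^ t * (1 - M * \<bar>x\<bar>) powr (real k + 1/2 - real t)"
    (is "\<bar>?R\<bar> \<le> ?B")
proof -
  define \<alpha> where "\<alpha> = real k + 1/2"
  have "M \<ge> 0"
    using M[of undefined] by linarith
  have "\<bar>a j * x\<bar> < 1" for j
    using mult_right_mono[OF M[of j], of "\<bar>x\<bar>"] assms(3) by (simp add: abs_mult)
  then have R: "(\<lambda>h. (\<alpha> gchoose h) * x ^ h * residue_moment a n h) sums ?R"
    unfolding \<alpha>_def by (rule linear_form_sums)
  let ?g = "\<lambda>h. \<bar>\<alpha> gchoose h\<bar> * \<bar>x\<bar> ^ h * (real (h choose t) * M ^ (h - t))"
  have "(\<lambda>m. \<bar>\<alpha> gchoose t\<bar> * \<bar>x\<bar> ^ t * (((\<alpha> - real t) gchoose m) * (- (M * \<bar>x\<bar>)) ^ m))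
          sums (\<bar>\<alpha> gchoose t\<bar> * \<bar>x\<bar> ^ t * (1 + - (M * \<bar>x\<bar>)) powr (\<alpha> - real t))"
    using assms(3) \<open>M \<ge> 0\<close> by (intro sums_mult gen_binomial_real) simp
  moreover have "?g (m + t) = \<bar>\<alpha> gchoose t\<bar> * \<bar>x\<bar> ^ t * (((\<alpha> - real t) gchoose m) * (- (M * \<bar>x\<bar>)) ^ m)" for m
  proof -
    have "\<bar>\<alpha> gchoose (m + t)\<bar> * real ((m + t) choose t) = \<bar>\<alpha> gchoose t\<bar> * \<bar>(\<alpha> - real t) gchoose m\<bar>"
      using gbinomial_trinomial_revision[of t "m + t" \<alpha>]
      by (simp add: binomial_gbinomial flip: abs_mult)
        (metis abs_mult abs_of_nat binomial_gbinomial of_nat_add)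
    also have "\<bar>(\<alpha> - real t) gchoose m\<bar> = (-1) ^ m * ((\<alpha> - real t) gchoose m)"
      using assms(5) by (intro abs_gbinomial_nonpos) (simp add: \<alpha>_def)
    finally have *: "\<bar>\<alpha> gchoose (m + t)\<bar> * real ((m + t) choose t)
        = \<bar>\<alpha> gchoose t\<bar> * ((-1) ^ m * ((\<alpha> - real t) gchoose m))" .
    have "?g (m + t) = (\<bar>\<alpha> gchoose (m + t)\<bar> * real ((m + t) choose t)) * (\<bar>x\<bar> ^ t * (M * \<bar>x\<bar>) ^ m)"
      by (simp add: power_add power_mult_distrib mult_ac)
    also have "\<dots> = \<bar>\<alpha> gchoose t\<bar> * \<bar>x\<bar> ^ t * (((\<alpha> - real t) gchoose m) * ((-1) ^ m * (M * \<bar>x\<bar>) ^ m))"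
      unfolding * by (simp add: mult_ac)
    also have "(-1) ^ m * (M * \<bar>x\<bar>) ^ m = (- (M * \<bar>x\<bar>)) ^ m"
      by (simp flip: power_mult_distrib)
    finally show ?thesis .
  qed
  ultimately have "(\<lambda>m. ?g (m + t)) sums ?B"
    by (simp add: \<alpha>_def)
  moreover have "?g h = 0" if "h < t" for h
    using that by simp
  ultimately have B: "?g sums ?B"
    by (subst (asm) sums_zero_iff_shift) auto
  have "\<bar>(\<alpha> gchoose h) * x ^ h * residue_moment a n h\<bar> \<le> ?g h" for h
    using mult_left_mono[OF residue_moment_bound[OF assms(1) M assms(4), of h],
        of "\<bar>\<alpha> gchoose h\<bar> * \<bar>x\<bar> ^ h"]
    by (simp add: abs_mult power_abs)
  then have "norm (\<Sum>h. (\<alpha> gchoose h) * x ^ h * residue_moment a n h) \<le> suminf ?g"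
    using sums_summable[OF B] by (intro norm_suminf_le) auto
  then show ?thesis
    using R B by (simp add: sums_iff)
qed

text \<open>The quotient of consecutive values is a rational function of k with limit 4/27 that
  never exceeds this limit in absolute value.\<close>

lemma abs_gbinomial_le:
  "\<bar>(real k + 1/2) gchoose (3 * k)\<bar> \<le> (4/27) ^ k"
proof (induction k)
  case (Suc k)
  define y where "y = real k"
  define d where "d = (3 * y + 1) * (3 * y + 2) * (3 * y + 3)"
  have y: "y \<ge> 0" "y * y \<ge> 0" "y * (y * y) \<ge> 0"
    by (simp_all add: y_def)
  have d: "d > 0" "4/27 * d = 4 * (y * (y * y)) + 8 * (y * y) + 44/9 * y + 8/9"
    using y by (simp add: d_def, simp add: d_def algebra_simps)
  have rec: "(b gchoose Suc m) = (b gchoose m) * ((b - m) / Suc m)" for b :: real and m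
    using gbinomial_mult_1[of b m] by (simp add: field_simps)
  \<comment> \<open>Absorption lowers both indices by one; two applications of \<open>rec\<close>
    then bring the lower index down to 3k.\<close>
  have "(real (Suc k) + 1/2) gchoose (3 * Suc k)
      = (y + 3/2) / (3 * y + 3) * ((y + 1/2) gchoose (Suc (Suc (3 * k))))"
    using gbinomial_absorption'[of "3 * Suc k" "real (Suc k) + 1/2"] by (simp add: y_def add_ac)
  also have "(y + 1/2) gchoose (Suc (Suc (3 * k)))
      = ((y + 1/2) gchoose (3 * k)) * ((1/2 - 2 * y) / (3 * y + 1)) * ((- 1/2 - 2 * y) / (3 * y + 2))"
  proof -
    have "y + 1/2 - real (3 * k) = 1/2 - 2 * y" "y + 1/2 - real (Suc (3 * k)) = - 1/2 - 2 * y"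
      "real (Suc (3 * k)) = 3 * y + 1" "real (Suc (Suc (3 * k))) = 3 * y + 2"
      by (simp_all add: y_def)
    then show ?thesis
      by (simp only: rec)
  qed
  also have "(y + 3/2) / (3 * y + 3) * (((y + 1/2) gchoose (3 * k)) * ((1/2 - 2 * y) / (3 * y + 1)) * ((- 1/2 - 2 * y) / (3 * y + 2)))
      = ((y + 3/2) * ((1/2 - 2 * y) * (- 1/2 - 2 * y))) / d * ((y + 1/2) gchoose (3 * k))"
  proof -
    have "p / d3 * (g * (q / d1) * (r / d2)) = (p * (q * r)) / (d1 * d2 * d3) * g" for p q r d1 d2 d3 g :: real
      by (simp add: mult_ac)
    then show ?thesis
      unfolding d_def by (simp only:)
  qed
  also have "(y + 3/2) * ((1/2 - 2 * y) * (- 1/2 - 2 * y))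
      = 4 * (y * (y * y)) + 6 * (y * y) - 1/4 * y - 3/8"
    by (simp add: algebra_simps)
  finally have eq: "(real (Suc k) + 1/2) gchoose (3 * Suc k)
      = (4 * (y * (y * y)) + 6 * (y * y) - 1/4 * y - 3/8) / d * ((y + 1/2) gchoose (3 * k))" .
  have "\<bar>4 * (y * (y * y)) + 6 * (y * y) - 1/4 * y - 3/8\<bar> \<le> 4/27 * d"
    unfolding d(2) using y by linarith
  then have "\<bar>(4 * (y * (y * y)) + 6 * (y * y) - 1/4 * y - 3/8) / d\<bar> \<le> 4/27"
    using d(1) by (simp only: abs_divide abs_of_pos pos_divide_le_eq)
  then show ?case
    unfolding eq abs_mult power_Suc using Suc.IH by (intro mult_mono) (simp_all add: y_def)
qed simp

section \<open>Nonvanishing\<close>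

definition node_poly :: "('n::finite \<Rightarrow> real) \<Rightarrow> real poly" where
  "node_poly a = (\<Prod>l\<in>UNIV. [:- a l, 1:])"

definition local_expansion :: "real \<Rightarrow> real poly \<Rightarrow> real fps" where
  "local_expansion b S = fps_of_poly (S \<circ>\<^sub>p [:b, 1:])"

definition cofactor_denom :: "('n::finite \<Rightarrow> real) \<Rightarrow> 'n \<Rightarrow> real fps" where
  "cofactor_denom a j = (\<Prod>l\<in>-{j}. fps_const (a j - a l) + fps_X)"

lemma local_expansion_simps:
  "local_expansion b (S + T) = local_expansion b S + local_expansion b T"
  "local_expansion b (S - T) = local_expansion b S - local_expansion b T"
  "local_expansion b (S * T) = local_expansion b S * local_expansion b T"
  "local_expansion b (smult c S) = fps_const c * local_expansion b S"
  "local_expansion b (pderiv S) = fps_deriv (local_expansion b S)"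
  "local_expansion b [:u, v:] = fps_const (u + b * v) + fps_const v * fps_X"
  by (simp_all add: local_expansion_def pcompose_add pcompose_diff pcompose_mult pcompose_smult
      fps_of_poly_add fps_of_poly_diff fps_of_poly_mult fps_of_poly_smult
      pderiv_pcompose pderiv_pCons pcompose_pCons fps_of_poly_pCons algebra_simps
      flip: fps_of_poly_pderiv fps_const_add fps_const_mult)

lemma local_expansion_prod:
  "local_expansion b (prod f A) = (\<Prod>i\<in>A. local_expansion b (f i))"
proof -
  have "local_expansion b 1 = 1"
    by (simp add: local_expansion_def pcompose_1)
  then show ?thesis
    by (induction A rule: infinite_finite_induct) (simp_all add: local_expansion_simps)
qed

lemma local_expansion_nth_0: "local_expansion b S $ 0 = poly S b"
  by (simp add: local_expansion_def poly_0_coeff_0[symmetric] poly_pcompose)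

lemma local_expansion_node_poly:
  "local_expansion (a j) (node_poly a) = fps_X * cofactor_denom a j"
proof -
  have "local_expansion (a j) (node_poly a)
      = (\<Prod>l\<in>UNIV. fps_const (a j - a l) + fps_X)"
    by (simp add: node_poly_def local_expansion_prod local_expansion_simps)
  also have "\<dots> = fps_X * (\<Prod>l\<in>UNIV-{j}. fps_const (a j - a l) + fps_X)"
    by (subst prod.remove[of _ j]) simp_all
  finally show ?thesis
    by (simp add: cofactor_denom_def Compl_eq_Diff_UNIV)
qed

lemma cofactor_denom_nth_0: "cofactor_denom a j $ 0 = (\<Prod>l\<in>-{j}. a j - a l)"
  by (simp add: cofactor_denom_def fps_prod_nth')

lemma cofactor_denom_nonzero: "inj a \<Longrightarrow> cofactor_denom a j $ 0 \<noteq> 0"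
  by (auto simp: cofactor_denom_nth_0 dest: injD)

lemma local_cofactor_const:
  "local_cofactor a (\<lambda>_. m) j = inverse (cofactor_denom a j) ^ m"
proof -
  have "inverse (\<Prod>l\<in>A. fps_const (a j - a l) + fps_X) = (\<Prod>l\<in>A. inverse (fps_const (a j - a l) + fps_X))" for A
    by (induction A rule: infinite_finite_induct) (simp_all add: fps_inverse_mult)
  then show ?thesis
    by (simp add: local_cofactor_def cofactor_denom_def prod_power_distrib)
qed

lemma degree_node_poly: "degree (node_poly (a :: 'n::finite \<Rightarrow> real)) = CARD('n)"
  and lead_coeff_node_poly: "coeff (node_poly a) CARD('n) = 1"
  and node_poly_nonzero: "node_poly a \<noteq> 0"
proof -
  show nz: "node_poly a \<noteq> 0"
    by (simp add: node_poly_def)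
  show *: "degree (node_poly a) = CARD('n)"
    by (simp add: node_poly_def degree_prod_sum_eq)
  have "lead_coeff (node_poly a) = 1"
    by (simp add: node_poly_def lead_coeff_prod)
  then show "coeff (node_poly a) CARD('n) = 1"
    by (simp add: *)
qed

lemma poly_node_poly: "poly (node_poly a) (a j) = 0"
  by (auto simp: node_poly_def poly_prod)

lemma poly_pderiv_node_poly:
  "poly (pderiv (node_poly a)) (a j) = cofactor_denom a j $ 0"
proof -
  have "poly (pderiv (node_poly a)) (a j) = fps_deriv (fps_X * cofactor_denom a j) $ 0"
    by (simp only: local_expansion_nth_0[symmetric] local_expansion_simps local_expansion_node_poly)
  then show ?thesis
    by simp
qed

section \<open>Interpolation at the nodes and Hermite reduction\<close>

lemma prod_linear_dvd:
  fixes a :: "'n \<Rightarrow> real"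
  assumes "finite F" "inj a" "\<And>j. j \<in> F \<Longrightarrow> poly p (a j) = 0"
  shows "(\<Prod>j\<in>F. [:- a j, 1:]) dvd p"
  using assms(1,3)
proof (induction F arbitrary: p rule: finite_induct)
  case (insert j F)
  then have "[:- a j, 1:] dvd p"
    by (simp add: poly_eq_0_iff_dvd)
  then obtain q where q: "p = [:- a j, 1:] * q"
    by (rule dvdE)
  have "poly q (a i) = 0" if "i \<in> F" for i
  proof -
    have "a i \<noteq> a j"
      using that insert.hyps assms(2) by (auto dest: injD)
    then show ?thesis
      using insert.prems[of i] that by (simp add: q)
  qed
  then have "(\<Prod>j\<in>F. [:- a j, 1:]) dvd q"
    by (rule insert.IH)
  then show ?case
    unfolding q prod.insert[OF insert.hyps] by (intro mult_dvd_mono dvd_refl)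
qed simp

lemma lagrange_interpolation:
  fixes a v :: "'n::finite \<Rightarrow> real"
  assumes "inj a"
  obtains T where "degree T < CARD('n)" "\<And>j. poly T (a j) = v j"
proof
  let ?L = "\<lambda>j. \<Prod>l\<in>-{j}. [:- a l, 1:]"
  let ?T = "\<Sum>j\<in>UNIV. smult (v j / poly (?L j) (a j)) (?L j)"
  have "degree (?L j) < CARD('n)" for j
    by (simp add: degree_prod_sum_eq Compl_eq_Diff_UNIV card_Diff_singleton card_gt_0_iff)
  then show "degree ?T < CARD('n)"
    by (intro degree_sum_less) (auto intro: le_less_trans[OF degree_smult_le])
  fix i
  have nz: "poly (?L i) (a i) \<noteq> 0"
    using assms by (auto simp: poly_prod dest: injD)
  have "poly (?L j) (a i) = 0" if "j \<noteq> i" for j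
    using that by (auto simp: poly_prod)
  then have "poly ?T (a i) = (\<Sum>j\<in>UNIV. if j = i then v i else 0)"
    unfolding poly_sum using nz by (intro sum.cong) auto
  then show "poly ?T (a i) = v i"
    by simp
qed

text \<open>Degree bounds replace exact degrees because the factors it is applied to, such as z T',
  may vanish.\<close>

lemma coeff_mult_top:
  assumes "degree p \<le> i" "degree q \<le> j"
  shows "coeff (p * q) (i + j) = coeff p i * (coeff q j :: real)"
proof (cases "degree p = i \<and> degree q = j")
  case True
  then show ?thesis
    using coeff_mult_degree_sum[of p q] by auto
next
  case False
  then have "degree p + degree q < i + j"
    using assms by auto
  then have "coeff (p * q) (i + j) = 0"
    using degree_mult_le[of p q] by (intro coeff_eq_0) linarith
  moreover have "coeff p i = 0 \<or> coeff q j = 0"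
    using False assms by (auto intro: coeff_eq_0)
  ultimately show ?thesis
    by auto
qed

text \<open>The polynomial \<open>\<Phi>\<close> for which
  \<open>((1 + x z)\<^bsup>\<alpha> + 1\<^esup> T / \<Pi>\<^bsup>m\<^esup>)' = (1 + x z)\<^bsup>\<alpha>\<^esup> \<Phi> / \<Pi>\<^bsup>m + 1\<^esup>\<close>, where \<open>\<Pi>\<close> is the node polynomial.\<close>

definition reduction_poly :: "('n::finite \<Rightarrow> real) \<Rightarrow> real \<Rightarrow> real \<Rightarrow> nat \<Rightarrow> real poly \<Rightarrow> real poly" where
  "reduction_poly a \<alpha> x m T = smult (x * (\<alpha> + 1)) (T * node_poly a)
     + [:1, x:] * (pderiv T * node_poly a - smult (real m) (T * pderiv (node_poly a)))"

text \<open>For x \<noteq> 0 and half-integral \<open>\<alpha>\<close> the factor in front of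
  \<open>lead_coeff T\<close> is nonzero, so only T = 0 yields a reduction polynomial of degree
  below the number of nodes.\<close>

lemma reduction_poly_degree:
  fixes a :: "'n::finite \<Rightarrow> real"
  shows "degree (reduction_poly a \<alpha> x m T) \<le> degree T + CARD('n)"
    and "coeff (reduction_poly a \<alpha> x m T) (degree T + CARD('n))
           = x * (\<alpha> + 1 + real (degree T) - real (m * CARD('n))) * lead_coeff T"
proof -
  define d where "d = degree T"
  define N where "N = node_poly a"
  have N: "degree N = CARD('n)" "coeff N CARD('n) = 1"
    by (simp_all add: N_def degree_node_poly lead_coeff_node_poly)
  define Q where "Q = pderiv T * N - smult (real m) (T * pderiv N)"
  \<comment> \<open>The operator z d/dz does not raise degrees and multiplies the n-th coefficient
    by n, so the top coefficient is read off z Q instead of Q.\<close>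
  have theta: "degree (pCons 0 (pderiv p)) \<le> degree p"
    "coeff (pCons 0 (pderiv p)) n = real n * coeff p n" for p :: "real poly" and n
  proof -
    show "coeff (pCons 0 (pderiv p)) n = real n * coeff p n" for n
      by (cases n) (simp_all add: coeff_pderiv)
    then show "degree (pCons 0 (pderiv p)) \<le> degree p"
      by (intro degree_le) (simp add: coeff_eq_0)
  qed
  have Q: "pCons 0 Q = pCons 0 (pderiv T) * N - smult (real m) (T * pCons 0 (pderiv N))"
    by (simp add: Q_def)
  have dQ: "degree (pCons 0 Q) \<le> d + CARD('n)"
    unfolding Q using theta(1)[of T] theta(1)[of N] N
    by (intro degree_diff_le order.trans[OF degree_smult_le] order.trans[OF degree_mult_le])
      (auto simp: d_def)
  have cQ: "coeff (pCons 0 Q) (d + CARD('n)) = (real d - real (m * CARD('n))) * lead_coeff T"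
    unfolding Q coeff_diff coeff_smult
    using theta(1)[of T] theta(1)[of N] N
    by (subst (1 2) coeff_mult_top) (simp_all only: theta d_def N order.refl, simp_all add: algebra_simps)
  have Phi: "reduction_poly a \<alpha> x m T = smult (x * (\<alpha> + 1)) (T * N) + (Q + smult x (pCons 0 Q))"
    by (simp add: reduction_poly_def Q_def N_def)
  have dQ': "degree Q < d + CARD('n)"
    using dQ by (cases "Q = 0") auto
  have dTN: "degree (T * N) \<le> d + CARD('n)"
    using degree_mult_le[of T N] N by (simp add: d_def)
  show "degree (reduction_poly a \<alpha> x m T) \<le> degree T + CARD('n)"
    unfolding Phi d_def[symmetric] using dTN dQ dQ'
    by (intro degree_add_le order.trans[OF degree_smult_le]) auto
  have "coeff (T * N) (d + CARD('n)) = lead_coeff T"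
    using N by (subst coeff_mult_top) (simp_all add: d_def)
  then show "coeff (reduction_poly a \<alpha> x m T) (degree T + CARD('n))
      = x * (\<alpha> + 1 + real (degree T) - real (m * CARD('n))) * lead_coeff T"
    unfolding Phi d_def[symmetric] coeff_add coeff_smult cQ
    using dQ' by (simp add: coeff_eq_0 algebra_simps)
qed

text \<open>The ring identity for X V' - m V with V = C E T U^m, used with \<open>t\<close> for
  \<open>fps_X\<close>, \<open>W\<close> for U^m and primes for derivatives.\<close>

lemma exact_form_algebra:
  fixes r U t x y E T C T' W m r' :: "'a::idom"
  assumes "r * U = 1"
  shows "t * ((x * E + y * E) * T * W + C * E * T' * W - m * (C * E * T * (W * U) * r')) - m * (C * E * T * W)
       = E * ((x + y) * (T * (t * r)) + C * (T' * (t * r) - m * (T * (r + t * r')))) * (W * U)"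
  using assms by algebra

text \<open>The integrand is locally the exact form d(V / X^m) with V = C E T U^m, and an exact form
  has no residue: X^m has the same coefficient in X V' and in m V.\<close>

lemma residue_reduction_poly:
  fixes a :: "'n::finite \<Rightarrow> real"
  assumes "inj a"
    and ode: "(fps_const (1 + a j * x) + fps_const x * fps_X) * fps_deriv E = fps_const (x * \<alpha>) * E"
  shows "(E * local_expansion (a j) (reduction_poly a \<alpha> x m T) * local_cofactor a (\<lambda>_. Suc m) j) $ m = 0"
proof -
  define r where "r = cofactor_denom a j"
  define U where "U = inverse r"
  define C where "C = fps_const (1 + a j * x) + fps_const x * fps_X"
  define T' where "T' = local_expansion (a j) T"
  have r0: "r $ 0 \<noteq> 0"
    using cofactor_denom_nonzero[OF assms(1)] by (simp add: r_def)
  then have rU: "r * U = 1"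
    by (simp add: U_def inverse_mult_eq_1')
  have "fps_deriv U = - fps_deriv r * U\<^sup>2"
    using r0 by (simp add: U_def fps_inverse_deriv)
  then have "fps_deriv (U ^ m) = - (of_nat m * (U ^ m * U * fps_deriv r))"
    by (induction m) (simp_all add: power2_eq_square algebra_simps)
  then have dU: "fps_deriv (U ^ m) = - (fps_const (real m) * (U ^ m * U * fps_deriv r))"
    by (simp add: fps_of_nat)
  have dC: "fps_deriv C = fps_const x"
    by (simp add: C_def)
  define V where "V = C * E * T' * U ^ m"
  have "fps_deriv V = (fps_deriv C * E + C * fps_deriv E) * T' * U ^ m + C * E * fps_deriv T' * U ^ m
      + C * E * T' * fps_deriv (U ^ m)"
    by (simp add: V_def algebra_simps)
  also have "C * fps_deriv E = fps_const (x * \<alpha>) * E"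
    using ode by (simp add: C_def)
  finally have dV: "fps_deriv V = (fps_const x * E + fps_const (x * \<alpha>) * E) * T' * U ^ m
      + C * E * fps_deriv T' * U ^ m - fps_const (real m) * (C * E * T' * (U ^ m * U) * fps_deriv r)"
    unfolding dC dU by (simp add: mult_ac)
  have "local_expansion (a j) (reduction_poly a \<alpha> x m T)
      = (fps_const x + fps_const (x * \<alpha>)) * (T' * (fps_X * r))
        + C * (fps_deriv T' * (fps_X * r) - fps_const (real m) * (T' * (r + fps_X * fps_deriv r)))"
    unfolding reduction_poly_def local_expansion_simps local_expansion_node_poly T'_def r_def C_def
    by (simp add: algebra_simps flip: fps_const_add)
  then have "E * local_expansion (a j) (reduction_poly a \<alpha> x m T) * local_cofactor a (\<lambda>_. Suc m) j
      = fps_X * fps_deriv V - fps_const (real m) * V"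
    unfolding dV local_cofactor_const r_def[symmetric] U_def[symmetric] power_Suc2
    by (simp only: V_def exact_form_algebra[OF rU])
  then show ?thesis
    by (cases m) simp_all
qed

text \<open>Hermite reduction: subtracting an exact form lowers the pole order at every node by one and
  keeps the degree of the numerator below the number of nodes.\<close>

lemma residues_zero_imp_zero:
  fixes a :: "'n::finite \<Rightarrow> real"
  assumes "inj a" and "x \<noteq> 0" and c: "\<And>j. 1 + a j * x \<noteq> 0" and E0: "\<And>j. E j $ 0 \<noteq> 0"
    and ode: "\<And>j. (fps_const (1 + a j * x) + fps_const x * fps_X) * fps_deriv (E j) = fps_const (x * \<alpha>) * E j"
    and \<alpha>: "\<And>d m. \<alpha> + 1 + real d - real (m * CARD('n)) \<noteq> 0"
    and "degree S < CARD('n)"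
    and "\<And>j. (E j * local_expansion (a j) S * local_cofactor a (\<lambda>_. Suc m) j) $ m = 0"
  shows "S = 0"
  using assms(7,8)
proof (induction m arbitrary: S)
  case 0
  \<comment> \<open>With simple poles the residues are nonzero multiples of the values S(a_j), so
    \<open>S\<close> has more roots than its degree allows.\<close>
  have S0: "poly S (a j) = 0" for j
    using 0(2)[of j] E0[of j] cofactor_denom_nonzero[OF assms(1), of j]
    by (simp add: local_expansion_nth_0 local_cofactor_const)
  have card: "card (range a) = CARD('n)"
    using assms(1) by (rule card_image)
  show ?case
  proof (rule poly_eqI_degree)
    show "poly S z = poly 0 z" if "z \<in> range a" for z
      using that S0 by (metis imageE poly_0)
    show "card (range a) > degree S" "card (range a) > degree (0 :: real poly)"
      unfolding card using 0(1) by simp_all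
  qed
next
  case (Suc m)
  let ?N = "node_poly a"
  \<comment> \<open>\<open>T\<close> is interpolated so that its reduction polynomial agrees with
    \<open>S\<close> at every node. The difference is then divisible by the node polynomial, which
    lowers the pole order.\<close>
  obtain T where T: "degree T < CARD('n)"
    "\<And>j. poly T (a j) = - poly S (a j) / (real (Suc m) * (1 + a j * x) * cofactor_denom a j $ 0)"
    by (rule lagrange_interpolation[OF assms(1),
          of "\<lambda>j. - poly S (a j) / (real (Suc m) * (1 + a j * x) * cofactor_denom a j $ 0)"]) (rule that)
  let ?P = "reduction_poly a \<alpha> x (Suc m) T"
  have "poly (S - ?P) (a j) = 0" for j
  proof -
    have "poly ?P (a j) = - (real (Suc m) * (1 + a j * x) * cofactor_denom a j $ 0) * poly T (a j)"
      unfolding reduction_poly_def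
      by (simp add: poly_node_poly poly_pderiv_node_poly algebra_simps del: of_nat_Suc)
    also have "\<dots> = poly S (a j)"
      using c[of j] cofactor_denom_nonzero[OF assms(1), of j] unfolding T(2)
      by (simp del: of_nat_Suc)
    finally show ?thesis
      by simp
  qed
  then obtain S' where S': "S - ?P = ?N * S'"
    using prod_linear_dvd[of UNIV a "S - ?P"] assms(1) unfolding node_poly_def by auto
  have "degree S' < CARD('n)"
  proof (cases "S' = 0")
    case False
    have "degree (S - ?P) \<le> degree T + CARD('n)"
      using Suc.prems(1) reduction_poly_degree(1)[of a \<alpha> x "Suc m" T] by (intro degree_diff_le) auto
    then show ?thesis
      using False T(1) unfolding S' by (simp add: degree_mult_eq node_poly_nonzero degree_node_poly)
  qed simp
  moreover have "(E j * local_expansion (a j) S' * local_cofactor a (\<lambda>_. Suc m) j) $ m = 0" for j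
  proof -
    let ?r = "cofactor_denom a j"
    have rU: "?r * inverse ?r = 1"
      using cofactor_denom_nonzero[OF assms(1)] by (rule inverse_mult_eq_1')
    have "S = ?P + ?N * S'"
      using S' by (simp add: algebra_simps)
    then have "local_expansion (a j) S = local_expansion (a j) ?P + fps_X * ?r * local_expansion (a j) S'"
      by (metis local_expansion_simps(1,3) local_expansion_node_poly)
    then have "E j * local_expansion (a j) S * local_cofactor a (\<lambda>_. Suc (Suc m)) j
        = E j * local_expansion (a j) ?P * local_cofactor a (\<lambda>_. Suc (Suc m)) j
          + fps_X * (?r * inverse ?r) * (E j * local_expansion (a j) S' * local_cofactor a (\<lambda>_. Suc m) j)"
      by (simp add: local_cofactor_const algebra_simps)
    then show ?thesis
      using Suc.prems(2)[of j] residue_reduction_poly[OF assms(1) ode, of j "Suc m" T]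
      by (simp add: rU mult.assoc)
  qed
  ultimately have "S' = 0"
    by (rule Suc.IH)
  then have SP: "S = ?P"
    using S' by simp
  \<comment> \<open>Now \<open>S\<close> is itself a reduction polynomial, of degree too small for a
    nonzero \<open>T\<close>.\<close>
  have "coeff ?P (degree T + CARD('n)) = 0"
    using Suc.prems(1) SP by (intro coeff_eq_0) simp
  then have "T = 0"
    using reduction_poly_degree(2)[of a \<alpha> x "Suc m" T] \<open>x \<noteq> 0\<close> \<alpha>[of "degree T" "Suc m"]
    by (simp del: of_nat_Suc of_nat_mult mult_Suc)
  then show ?case
    using SP by (simp add: reduction_poly_def)
qed

text \<open>The differential equation of (c + x X)^(k + 1/2), through which the Hermite reduction
  sees the square root; coefficientwise it is the recurrence of the binomial coefficients.\<close>

lemma root_germ_ode: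
  assumes "c \<noteq> 0"
  shows "(fps_const c + fps_const x * fps_X) * fps_deriv (root_germ k c x)
           = fps_const (x * (real k + 1/2)) * root_germ k c x"
proof (rule fps_ext)
  fix s
  define \<alpha> where "\<alpha> = real k + 1/2"
  have rec: "real (Suc s) * (\<alpha> gchoose Suc s) = (\<alpha> - real s) * (\<alpha> gchoose s)"
    using gbinomial_mult_1[of \<alpha> s] by (simp add: algebra_simps)
  have "((fps_const c + fps_const x * fps_X) * fps_deriv (root_germ k c x)) $ s
      = c * (real (Suc s) * root_germ k c x $ Suc s) + x * (real s * root_germ k c x $ s)"
    by (cases s) (simp_all add: distrib_right mult.assoc del: of_nat_Suc)
  also have "c * (real (Suc s) * root_germ k c x $ Suc s)
      = (real (Suc s) * (\<alpha> gchoose Suc s)) * (c ^ k * (x / c) ^ s * x)"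
    using assms by (simp add: root_germ_def \<alpha>_def)
  also have "\<dots> + x * (real s * root_germ k c x $ s) = x * \<alpha> * root_germ k c x $ s"
    unfolding rec by (simp add: root_germ_def \<alpha>_def algebra_simps)
  finally show "((fps_const c + fps_const x * fps_X) * fps_deriv (root_germ k c x)) $ s
      = (fps_const (x * (real k + 1/2)) * root_germ k c x) $ s"
    by (simp add: \<alpha>_def)
qed

section \<open>The coefficient matrix of the linear forms and its nonsingularity\<close>

definition pade_orders :: "nat \<Rightarrow> 'n \<Rightarrow> 'n \<Rightarrow> nat" where
  "pade_orders k i = (\<lambda>l. if l = i then Suc k else k)"

text \<open>The coefficient of sqrt(1 + a_j x) in the form whose node \<open>i\<close> is taken k +
  1 times; the forms are the rows of a square matrix.\<close>

definition pade_coeff :: "('n::finite \<Rightarrow> real) \<Rightarrow> real \<Rightarrow> nat \<Rightarrow> 'n \<Rightarrow> 'n \<Rightarrow> real" where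
  "pade_coeff a x k i j = local_residue a (pade_orders k i) j (root_germ k (1 + a j * x) x)"

lemma sum_pade_orders: "sum (pade_orders k i) (UNIV :: 'n::finite set) = Suc (k * CARD('n))"
proof -
  have "sum (pade_orders k i) UNIV = (\<Sum>l\<in>UNIV. k + (if l = i then 1 else 0))"
    by (intro sum.cong) (auto simp: pade_orders_def)
  then show ?thesis
    by (simp add: sum.distrib)
qed

lemma local_residue_mult_linear_prod:
  fixes a :: "'n::finite \<Rightarrow> real"
  assumes "inj a"
  shows "local_residue a (\<lambda>_. Suc k) j ((\<Prod>l\<in>F. fps_const (a j - a l) + fps_X) * f)
           = local_residue a (\<lambda>l. if l \<in> F then k else Suc k) j f"
proof -
  have "finite F"
    by simp
  then show ?thesis
  proof (induction F arbitrary: f rule: finite_induct)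
    case (insert i F)
    let ?n = "\<lambda>l. if l \<in> F then k else Suc k"
    have "?n(i := ?n i - 1) = (\<lambda>l. if l \<in> insert i F then k else Suc k)"
      using insert.hyps by auto
    moreover have "local_residue a ?n j ((fps_const (a j - a i) + fps_X) * f)
        = local_residue a (?n(i := ?n i - 1)) j f"
      using insert.hyps by (intro local_residue_mult_linear assms) simp
    moreover have "(\<Prod>l\<in>insert i F. fps_const (a j - a l) + fps_X) * f
        = (\<Prod>l\<in>F. fps_const (a j - a l) + fps_X) * ((fps_const (a j - a i) + fps_X) * f)"
      unfolding prod.insert[OF insert.hyps] by (simp only: mult_ac)
    ultimately show ?case
      using insert.IH[of "(fps_const (a j - a i) + fps_X) * f"] by metis
  qed simp
qed

text \<open>Puts all forms over the same denominator, the node polynomial to the power k + 1, so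
  that a linear combination of rows becomes a single numerator.\<close>

lemma pade_coeff_eq_residue:
  "inj a \<Longrightarrow> pade_coeff a x k i j = (root_germ k (1 + a j * x) x
     * local_expansion (a j) (\<Prod>l\<in>-{i}. [:- a l, 1:]) * local_cofactor a (\<lambda>_. Suc k) j) $ k"
proof -
  assume "inj a"
  have "local_expansion (a j) (\<Prod>l\<in>-{i}. [:- a l, 1:]) = (\<Prod>l\<in>-{i}. fps_const (a j - a l) + fps_X)"
    by (simp add: local_expansion_prod local_expansion_simps)
  moreover have "(\<lambda>l. if l \<in> - {i} then k else Suc k) = pade_orders k i"
    by (auto simp: pade_orders_def)
  ultimately have "pade_coeff a x k i j
      = local_residue a (\<lambda>_. Suc k) j (local_expansion (a j) (\<Prod>l\<in>-{i}. [:- a l, 1:]) * root_germ k (1 + a j * x) x)"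
    using local_residue_mult_linear_prod[OF \<open>inj a\<close>, of k j "-{i}"] by (simp add: pade_coeff_def)
  then show ?thesis
    by (simp add: local_residue_def mult_ac)
qed

text \<open>A vanishing combination of rows has a numerator \<open>S\<close> of degree below the
  number of nodes and only zero residues. Hence S = 0, and evaluation at a_i isolates w_i.\<close>

lemma pade_rows_independent:
  fixes a :: "'n::finite \<Rightarrow> real"
  assumes "inj a" and "x \<noteq> 0" and c: "\<And>j. 1 + a j * x \<noteq> 0"
    and zero: "\<And>j. (\<Sum>i\<in>UNIV. w i * pade_coeff a x k i j) = 0"
  shows "w i = 0"
proof -
  let ?L = "\<lambda>i. \<Prod>l\<in>-{i}. [:- a l, 1:]"
  define S where "S = (\<Sum>i\<in>UNIV. smult (w i) (?L i))"
  have deg: "degree S < CARD('n)"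
  proof -
    have "degree (?L j) < CARD('n)" for j
      by (simp add: degree_prod_sum_eq Compl_eq_Diff_UNIV card_Diff_singleton card_gt_0_iff)
    then show ?thesis
      unfolding S_def by (intro degree_sum_less) (auto intro: le_less_trans[OF degree_smult_le])
  qed
  have exp: "local_expansion b (\<Sum>i\<in>A. smult (w i) (?L i)) = (\<Sum>i\<in>A. fps_const (w i) * local_expansion b (?L i))" for b A
  proof -
    have "local_expansion b 0 = 0"
      by (simp add: local_expansion_def)
    then show ?thesis
      by (induction A rule: infinite_finite_induct) (simp_all add: local_expansion_simps)
  qed
  have res: "(root_germ k (1 + a j * x) x * local_expansion (a j) S * local_cofactor a (\<lambda>_. Suc k) j) $ k = 0" for j
    using zero[of j] unfolding S_def exp pade_coeff_eq_residue[OF assms(1)]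
    by (simp add: sum_distrib_left sum_distrib_right fps_sum_nth mult_ac)
  have "S = 0"
  proof (rule residues_zero_imp_zero[of a x "\<lambda>j. root_germ k (1 + a j * x) x" "real k + 1/2" S k])
    \<comment> \<open>The number k + 3/2 + d is never an integer; doubling gives a parity
      contradiction.\<close>
    show "real k + 1/2 + 1 + real d - real (m * CARD('n)) \<noteq> 0" for d m
    proof
      assume "real k + 1/2 + 1 + real d - real (m * CARD('n)) = 0"
      then have "real (2 * k + 3 + 2 * d) = real (2 * (m * CARD('n)))"
        by simp
      then have "2 * k + 3 + 2 * d = 2 * (m * CARD('n))"
        by (simp only: of_nat_eq_iff)
      then show False
        by presburger
    qed
    show "root_germ k (1 + a j * x) x $ 0 \<noteq> 0" for j
      using c[of j] by (simp add: root_germ_def)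
  qed (use assms deg res root_germ_ode[OF c] in auto)
  have "poly (?L j) (a i) = 0" if "j \<noteq> i" for j
    using that by (auto simp: poly_prod)
  then have "poly S (a i) = (\<Sum>j\<in>UNIV. if j = i then w i * poly (?L i) (a i) else 0)"
    unfolding S_def poly_sum poly_smult by (intro sum.cong) auto
  then have "poly S (a i) = w i * poly (?L i) (a i)"
    by simp
  moreover have "poly (?L i) (a i) \<noteq> 0"
    using assms(1) by (auto simp: poly_prod dest: injD)
  ultimately show ?thesis
    using \<open>S = 0\<close> by simp
qed

lemma pade_nonsingular:
  fixes a :: "'n::finite \<Rightarrow> real"
  assumes "inj a" and "x \<noteq> 0" and "\<And>j. 1 + a j * x \<noteq> 0" and "v j \<noteq> 0"
  shows "\<exists>i. (\<Sum>j\<in>UNIV. pade_coeff a x k i j * v j) \<noteq> 0"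
  using rows_independent_imp_kernel_trivial[of "pade_coeff a x k" v j]
    pade_rows_independent[OF assms(1-3)] assms(4) by blast

section \<open>Integrality\<close>

text \<open>For upper index -1/2 the value is (-1)^s (2s choose s). Pascal's rule raises the upper
  index one at a time and preserves integrality.\<close>

lemma pow4_gbinomial_half_Ints: "4 ^ s * ((real k + 1/2) gchoose s) \<in> \<int>"
proof -
  have base: "4 ^ s * ((- 1/2 :: real) gchoose s) = (-1) ^ s * real ((2 * s) choose s)" for s
  proof (induction s)
    case (Suc s)
    have "real (Suc s) * ((- 1/2 :: real) gchoose Suc s) = (- 1/2 - real s) * ((- 1/2) gchoose s)"
      unfolding left_diff_distrib using gbinomial_mult_1[of "- 1/2 :: real" s] by linarith
    then have "real (Suc s) * (4 ^ Suc s * ((- 1/2 :: real) gchoose Suc s))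
        = 4 * (- 1/2 - real s) * (4 ^ s * ((- 1/2 :: real) gchoose s))"
      by (metis (no_types, opaque_lifting) mult.assoc mult.left_commute power_Suc)
    also have "\<dots> = real (Suc s) * ((-1) ^ Suc s * real ((2 * Suc s) choose Suc s))"
    proof -
      have "Suc s * ((2 * Suc s) choose Suc s) = (2 * Suc s) * (Suc (2 * s) choose s)"
        using Suc_times_binomial_eq[of "Suc (2 * s)" s] by simp
      moreover have "Suc s * (Suc (2 * s) choose s) = Suc (2 * s) * ((2 * s) choose s)"
        using binomial_absorb_comp[of "Suc (2 * s)" s] by (simp add: Suc_diff_le)
      ultimately have "Suc s * ((2 * Suc s) choose Suc s) = 2 * (Suc (2 * s) * ((2 * s) choose s))"
        by (metis mult.assoc mult.left_commute)
      then have "real (Suc s) * real ((2 * Suc s) choose Suc s) = 2 * ((2 * real s + 1) * real ((2 * s) choose s))"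
        by (metis (no_types, lifting) of_nat_1 of_nat_Suc of_nat_add of_nat_mult of_nat_numeral add.commute)
      then have "real (Suc s) * ((-1) ^ Suc s * real ((2 * Suc s) choose Suc s))
          = (-1) ^ Suc s * (2 * ((2 * real s + 1) * real ((2 * s) choose s)))"
        by (metis mult.left_commute)
      then show ?thesis
        unfolding Suc.IH by (simp add: algebra_simps del: of_nat_Suc binomial_Suc_Suc mult_Suc_right)
    qed
    finally show ?case
      by (simp del: of_nat_Suc power_Suc)
  qed simp
  have "4 ^ s * ((real k - 1/2) gchoose s) \<in> \<int>" for k s
  proof (induction k arbitrary: s)
    case 0
    then show ?case
      using base[of s] by simp
  next
    case (Suc k)
    show ?case
    proof (cases s)
      case (Suc t)
      have "4 ^ s * ((real (Suc k) - 1/2) gchoose s)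
          = 4 * (4 ^ t * ((real k - 1/2) gchoose t)) + 4 ^ Suc t * ((real k - 1/2) gchoose Suc t)"
        using gbinomial_Suc_Suc[of "real k - 1/2" t] unfolding Suc by (simp add: algebra_simps)
      then show ?thesis
        using Suc.IH[of t] Suc.IH[of "Suc t"] by (metis Ints_add Ints_mult Ints_numeral)
    qed simp
  qed
  from this[of s "Suc k"] show ?thesis
    by (simp add: algebra_simps)
qed

lemma inverse_linear_nth:
  assumes "d \<noteq> (0::real)"
  shows "inverse (fps_const d + fps_X) $ u = (-1) ^ u / d ^ Suc u"
proof -
  have "(fps_const d + fps_X) * Abs_fps (\<lambda>u. (-1) ^ u / d ^ Suc u) = 1"
  proof (rule fps_ext)
    fix u
    show "((fps_const d + fps_X) * Abs_fps (\<lambda>u. (-1) ^ u / d ^ Suc u)) $ u = 1 $ u"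
      using assms by (cases u) (simp_all add: distrib_right)
  qed
  then have "inverse (fps_const d + fps_X) = Abs_fps (\<lambda>u. (-1) ^ u / d ^ Suc u)"
    by (simp add: fps_inverse_unique)
  then show ?thesis
    by simp
qed

text \<open>In the induction the convolution splits d^(n + 1 + u) as d^(i + 1) d^(n + u - i), one
  part clearing the geometric series and the other the lower power.\<close>

lemma inverse_linear_power_Ints:
  assumes "d \<in> \<int>" "d \<noteq> (0::real)"
  shows "d ^ (n + u) * (inverse (fps_const d + fps_X) ^ n) $ u \<in> \<int>"
proof (induction n arbitrary: u)
  case (Suc n)
  have "d ^ (Suc n + u) * (inverse (fps_const d + fps_X) ^ Suc n) $ u
      = (\<Sum>i=0..u. (-1) ^ i * (d ^ (n + (u - i)) * (inverse (fps_const d + fps_X) ^ n) $ (u - i)))"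
    unfolding power_Suc fps_mult_nth sum_distrib_left
  proof (rule sum.cong)
    fix i assume "i \<in> {0..u}"
    then have "d ^ (Suc n + u) = d ^ Suc i * d ^ (n + (u - i))"
      by (simp flip: power_add)
    then show "d ^ (Suc n + u) * (inverse (fps_const d + fps_X) $ i * (inverse (fps_const d + fps_X) ^ n) $ (u - i))
        = (-1) ^ i * (d ^ (n + (u - i)) * (inverse (fps_const d + fps_X) ^ n) $ (u - i))"
      using assms(2) by (simp add: inverse_linear_nth)
  qed simp
  also have "\<dots> \<in> \<int>"
    by (intro Ints_sum Ints_mult Ints_power Suc.IH) simp
  finally show ?case .
qed simp

text \<open>A common exponent e serves all factors: in the convolution each receives an index at
  most u, and n_l + u \<le> e leaves room for it.\<close>

lemma inverse_linear_prod_Ints: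
  fixes d :: "'i \<Rightarrow> real"
  assumes "finite F" and "\<And>l. l \<in> F \<Longrightarrow> d l \<in> \<int> \<and> d l \<noteq> 0 \<and> n l + u \<le> e"
  shows "(\<Prod>l\<in>F. d l) ^ e * (\<Prod>l\<in>F. inverse (fps_const (d l) + fps_X) ^ n l) $ u \<in> \<int>"
  using assms
proof (induction F arbitrary: u rule: finite_induct)
  case (insert i F)
  have "(\<Prod>l\<in>insert i F. d l) ^ e * (\<Prod>l\<in>insert i F. inverse (fps_const (d l) + fps_X) ^ n l) $ u
     = (\<Sum>v=0..u. (d i ^ e * (inverse (fps_const (d i) + fps_X) ^ n i) $ v)
          * ((\<Prod>l\<in>F. d l) ^ e * (\<Prod>l\<in>F. inverse (fps_const (d l) + fps_X) ^ n l) $ (u - v)))"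
    unfolding prod.insert[OF insert.hyps] fps_mult_nth sum_distrib_left
    by (intro sum.cong) (simp_all add: power_mult_distrib)
  also have "\<dots> \<in> \<int>"
  proof (rule Ints_sum, rule Ints_mult)
    fix v assume v: "v \<in> {0..u}"
    have "d i ^ e = d i ^ (e - (n i + v)) * d i ^ (n i + v)"
      using insert.prems[of i] v by (simp flip: power_add)
    then show "d i ^ e * (inverse (fps_const (d i) + fps_X) ^ n i) $ v \<in> \<int>"
      using inverse_linear_power_Ints[of "d i" "n i" v] insert.prems[of i]
      by (simp add: mult.assoc)
    show "(\<Prod>l\<in>F. d l) ^ e * (\<Prod>l\<in>F. inverse (fps_const (d l) + fps_X) ^ n l) $ (u - v) \<in> \<int>"
    proof (rule insert.IH)
      show "d l \<in> \<int> \<and> d l \<noteq> 0 \<and> n l + (u - v) \<le> e" if "l \<in> F" for l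
        using insert.prems[of l] that by auto
    qed
  qed
  finally show ?case .
next
  case empty
  show ?case
    by (cases u) auto
qed

text \<open>In the s-th term, (4N)^k clears the binomial coefficient and the powers of N, and 4 N c
  = 2 D_j \<mu> leaves D_j^(k - s). Then H^k adds D_j^k, and D_j^(2k - s) clears the cofactor
  coefficient of index m - s.\<close>

lemma pade_coeff_Ints:
  fixes a :: "'n::finite \<Rightarrow> real"
  defines "D \<equiv> \<lambda>j. \<Prod>l\<in>-{j}. a j - a l"
  assumes "inj a" and int: "\<And>l. a l \<in> \<int>" and "\<epsilon> \<in> \<int>" and "N \<noteq> 0" and nz: "N + a j * \<epsilon> \<noteq> 0"
    and \<mu>: "\<mu> \<in> \<int>" "2 * (N + a j * \<epsilon>) = D j * \<mu>" and \<nu>: "\<nu> \<in> \<int>" "H = D j * \<nu>"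
  shows "(4 * N * H) ^ k * pade_coeff a (\<epsilon> / N) k i j \<in> \<int>"
proof (cases "pade_orders k i j")
  case 0
  then show ?thesis
    by (simp add: pade_coeff_def local_residue_def)
next
  case (Suc m)
  define n where "n = pade_orders k i"
  define c where "c = 1 + a j * (\<epsilon> / N)"
  have c: "c \<noteq> 0" "N * c = N + a j * \<epsilon>"
    using nz \<open>N \<noteq> 0\<close> by (simp_all add: c_def field_simps)
  have m: "m \<le> k"
    using Suc by (auto simp: pade_orders_def split: if_splits)
  \<comment> \<open>Either i = j, so that m = k and the other orders are k, or m = k - 1 and the
    other orders are at most k + 1.\<close>
  have nm: "n l + m \<le> 2 * k" if "l \<noteq> j" for l
    using that Suc by (auto simp: n_def pade_orders_def split: if_splits)
  have "pade_coeff a (\<epsilon> / N) k i j = (\<Sum>s=0..m. root_germ k c (\<epsilon> / N) $ s * local_cofactor a n j $ (m - s))"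
    using Suc unfolding pade_coeff_def local_residue_def n_def[symmetric] c_def[symmetric]
    by (simp add: fps_mult_nth)
  then have "(4 * N * H) ^ k * pade_coeff a (\<epsilon> / N) k i j
      = (\<Sum>s=0..m. (4 * N * H) ^ k * (root_germ k c (\<epsilon> / N) $ s * local_cofactor a n j $ (m - s)))"
    by (simp add: sum_distrib_left)
  also have "\<dots> = (\<Sum>s=0..m. 4 ^ s * ((real k + 1/2) gchoose s) * \<epsilon> ^ s * 2 ^ (k - s) * \<mu> ^ (k - s) * \<nu> ^ k
      * (D j ^ (2 * k - s) * local_cofactor a n j $ (m - s)))"
  proof (intro sum.cong refl)
    fix s assume "s \<in> {0..m}"
    then have s: "s \<le> k"
      using m by simp
    have "(4 * N) ^ k * root_germ k c (\<epsilon> / N) $ s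
        = ((4 * (N * c)) ^ k / (4 * (N * c)) ^ s) * (4 ^ s * ((real k + 1/2) gchoose s) * \<epsilon> ^ s)"
      using c(1) \<open>N \<noteq> 0\<close> by (simp add: root_germ_def power_mult_distrib power_divide)
    also have "(4 * (N * c)) ^ k / (4 * (N * c)) ^ s = (4 * (N * c)) ^ (k - s)"
      using s c(1) \<open>N \<noteq> 0\<close> by (simp add: power_diff)
    also have "4 * (N * c) = 2 * (D j * \<mu>)"
      unfolding c(2) \<mu>(2)[symmetric] by simp
    finally have 1: "(4 * N) ^ k * root_germ k c (\<epsilon> / N) $ s
        = (2 * (D j * \<mu>)) ^ (k - s) * (4 ^ s * ((real k + 1/2) gchoose s) * \<epsilon> ^ s)" .
    have 2: "D j ^ (2 * k - s) = D j ^ (k - s) * D j ^ k"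
      using s by (simp flip: power_add add: mult_2)
    have "(4 * N * H) ^ k * (root_germ k c (\<epsilon> / N) $ s * local_cofactor a n j $ (m - s))
        = ((4 * N) ^ k * root_germ k c (\<epsilon> / N) $ s) * (H ^ k * local_cofactor a n j $ (m - s))"
      by (simp only: power_mult_distrib mult_ac)
    also have "H ^ k = D j ^ k * \<nu> ^ k"
      by (simp add: \<nu>(2) power_mult_distrib)
    finally show "(4 * N * H) ^ k * (root_germ k c (\<epsilon> / N) $ s * local_cofactor a n j $ (m - s))
        = 4 ^ s * ((real k + 1/2) gchoose s) * \<epsilon> ^ s * 2 ^ (k - s) * \<mu> ^ (k - s) * \<nu> ^ k
            * (D j ^ (2 * k - s) * local_cofactor a n j $ (m - s))"
      unfolding 1 2 by (simp only: power_mult_distrib mult_ac)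
  qed
  also have "\<dots> \<in> \<int>"
  proof (intro Ints_sum Ints_mult[OF Ints_mult[OF Ints_mult[OF Ints_mult[OF Ints_mult]]]])
    fix s assume s: "s \<in> {0..m}"
    show "D j ^ (2 * k - s) * local_cofactor a n j $ (m - s) \<in> \<int>"
      unfolding D_def local_cofactor_def
    proof (rule inverse_linear_prod_Ints)
      show "a j - a l \<in> \<int> \<and> a j - a l \<noteq> 0 \<and> n l + (m - s) \<le> 2 * k - s" if "l \<in> - {j}" for l
        using that int nm[of l] s assms(2) by (auto intro: Ints_diff dest: injD)
    qed simp
  qed (use pow4_gbinomial_half_Ints assms in auto)
  finally show ?thesis .
qed

section \<open>Size of the coefficients\<close>

text \<open>A truncated weighted l1 norm. It is submultiplicative and takes the place of Cauchy's
  estimate on the circle of radius r.\<close>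

definition majorant_sum :: "real \<Rightarrow> nat \<Rightarrow> real fps \<Rightarrow> real" where
  "majorant_sum r m f = (\<Sum>u=0..m. \<bar>f $ u\<bar> * r ^ u)"

lemma majorant_sum_nonneg: "r \<ge> 0 \<Longrightarrow> majorant_sum r m f \<ge> 0"
  by (simp add: majorant_sum_def sum_nonneg)

lemma majorant_sum_mult:
  assumes "r \<ge> 0"
  shows "majorant_sum r m (f * g) \<le> majorant_sum r m f * majorant_sum r m g"
proof -
  have "majorant_sum r m (f * g) \<le> (\<Sum>u=0..m. \<Sum>i=0..u. (\<bar>f $ i\<bar> * r ^ i) * (\<bar>g $ (u - i)\<bar> * r ^ (u - i)))"
    unfolding majorant_sum_def
  proof (rule sum_mono)
    fix u
    have "\<bar>(f * g) $ u\<bar> * r ^ u \<le> (\<Sum>i=0..u. \<bar>f $ i * g $ (u - i)\<bar>) * r ^ u"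
      unfolding fps_mult_nth using assms by (intro mult_right_mono sum_abs) simp
    also have "\<dots> = (\<Sum>i=0..u. (\<bar>f $ i\<bar> * r ^ i) * (\<bar>g $ (u - i)\<bar> * r ^ (u - i)))"
      unfolding sum_distrib_right
    proof (intro sum.cong refl)
      fix i assume "i \<in> {0..u}"
      then have "r ^ u = r ^ i * r ^ (u - i)"
        by (simp flip: power_add)
      then show "\<bar>f $ i * g $ (u - i)\<bar> * r ^ u = \<bar>f $ i\<bar> * r ^ i * (\<bar>g $ (u - i)\<bar> * r ^ (u - i))"
        by (simp add: abs_mult)
    qed
    finally show "\<bar>(f * g) $ u\<bar> * r ^ u \<le> \<dots>" .
  qed
  also have "\<dots> = (\<Sum>(u, i)\<in>(SIGMA u:{0..m}. {0..u}). (\<bar>f $ i\<bar> * r ^ i) * (\<bar>g $ (u - i)\<bar> * r ^ (u - i)))"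
    by (rule sum.Sigma) auto
  also have "\<dots> = (\<Sum>(i, v)\<in>(SIGMA i:{0..m}. {0..m - i}). (\<bar>f $ i\<bar> * r ^ i) * (\<bar>g $ v\<bar> * r ^ v))"
    by (rule sum.reindex_bij_witness[of _ "\<lambda>(i, v). (i + v, i)" "\<lambda>(u, i). (i, u - i)"]) auto
  \<comment> \<open>The triangle i + v \<le> m lies in the full square, and all terms are
    nonnegative.\<close>
  also have "\<dots> \<le> (\<Sum>(i, v)\<in>{0..m} \<times> {0..m}. (\<bar>f $ i\<bar> * r ^ i) * (\<bar>g $ v\<bar> * r ^ v))"
    using assms by (intro sum_mono2) auto
  also have "\<dots> = majorant_sum r m f * majorant_sum r m g"
    by (simp add: majorant_sum_def sum_product sum.cartesian_product)
  finally show ?thesis .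
qed

lemma majorant_sum_1: "majorant_sum r m 1 = 1"
proof -
  have "majorant_sum r m 1 = (\<Sum>u\<in>{0..m}. if u = 0 then 1 else 0)"
    unfolding majorant_sum_def by (intro sum.cong) auto
  then show ?thesis
    by simp
qed

lemma majorant_sum_power:
  assumes "r \<ge> 0" "majorant_sum r m f \<le> B"
  shows "majorant_sum r m (f ^ n) \<le> B ^ n"
proof (induction n)
  case (Suc n)
  have "majorant_sum r m (f ^ Suc n) \<le> majorant_sum r m f * majorant_sum r m (f ^ n)"
    using majorant_sum_mult[OF assms(1)] by simp
  also have "\<dots> \<le> B * B ^ n"
    using assms Suc.IH by (intro mult_mono) (auto intro: majorant_sum_nonneg order.trans[OF majorant_sum_nonneg])
  finally show ?case
    by simp
qed (simp add: majorant_sum_1)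

lemma majorant_sum_prod:
  assumes "finite F" "r \<ge> 0" "\<And>l. l \<in> F \<Longrightarrow> majorant_sum r m (f l) \<le> B l"
  shows "majorant_sum r m (\<Prod>l\<in>F. f l) \<le> (\<Prod>l\<in>F. B l)"
  using assms(1,3)
proof (induction F rule: finite_induct)
  case (insert i F)
  have "majorant_sum r m (\<Prod>l\<in>insert i F. f l) \<le> majorant_sum r m (f i) * majorant_sum r m (\<Prod>l\<in>F. f l)"
    using majorant_sum_mult[OF assms(2)] insert.hyps by simp
  also have "\<dots> \<le> B i * (\<Prod>l\<in>F. B l)"
    using insert assms(2) by (intro mult_mono) (auto intro: majorant_sum_nonneg order.trans[OF majorant_sum_nonneg])
  finally show ?case
    using insert.hyps by simp
qed (simp add: majorant_sum_1)

lemma majorant_sum_inverse_linear: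
  assumes "r \<ge> 0" "r < \<bar>d\<bar>"
  shows "majorant_sum r m (inverse (fps_const d + fps_X)) \<le> inverse (\<bar>d\<bar> - r)"
proof -
  have "d \<noteq> 0"
    using assms by auto
  have "majorant_sum r m (inverse (fps_const d + fps_X)) = (\<Sum>u<Suc m. (r / \<bar>d\<bar>) ^ u) / \<bar>d\<bar>"
    unfolding majorant_sum_def sum_divide_distrib inverse_linear_nth[OF \<open>d \<noteq> 0\<close>]
    by (intro sum.cong) (auto simp: abs_mult power_abs power_divide abs_divide)
  also have "\<dots> \<le> (1 / (1 - r / \<bar>d\<bar>)) / \<bar>d\<bar>"
  proof (intro divide_right_mono)
    have "norm (r / \<bar>d\<bar>) < 1"
      using assms \<open>d \<noteq> 0\<close> by (simp add: abs_of_nonneg)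
    from geometric_sums[OF this] show "(\<Sum>u<Suc m. (r / \<bar>d\<bar>) ^ u) \<le> 1 / (1 - r / \<bar>d\<bar>)"
      unfolding sums_iff
      using assms(1) by (metis (no_types, lifting) sum_le_suminf finite_lessThan zero_le_power divide_nonneg_nonneg abs_ge_zero)
  qed simp
  also have "\<dots> = inverse (\<bar>d\<bar> - r)"
  proof -
    have "(1 / (1 - r / e)) / e = inverse (e - r)" if "e > r" "e > 0" for e
      using that by (simp add: field_simps)
    then show ?thesis
      using assms(2) \<open>d \<noteq> 0\<close> by simp
  qed
  finally show ?thesis .
qed

text \<open>Each factor k + 1/2 - i with i \<le> k is nonnegative and at most k + 1 - i.\<close>

lemma gbinomial_half_le:
  assumes "s \<le> Suc k"
  shows "0 \<le> (real k + 1/2) gchoose s \<and> (real k + 1/2) gchoose s \<le> real (Suc k choose s)"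
  using assms
proof (induction s)
  case (Suc s)
  have rec: "(b gchoose Suc s) = (b gchoose s) * ((b - s) / Suc s)" for b :: real
    using gbinomial_mult_1[of b s] by (simp add: field_simps)
  have "real (Suc k choose Suc s) = real (Suc k choose s) * ((real (Suc k) - s) / Suc s)"
    using rec[of "real (Suc k)"] by (simp only: binomial_gbinomial)
  moreover have "0 \<le> (real k + 1/2 - s) / Suc s" "(real k + 1/2 - s) / Suc s \<le> (real (Suc k) - s) / Suc s"
    using Suc.prems by (simp_all add: divide_right_mono)
  moreover have "0 \<le> (real k + 1/2) gchoose s" "(real k + 1/2) gchoose s \<le> real (Suc k choose s)"
    using Suc by simp_all
  ultimately show ?case
    unfolding rec[of "real k + 1/2"] by (metis mult_mono mult_nonneg_nonneg of_nat_0_le_iff)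
qed simp

text \<open>Comparison with the binomial expansion of (C + |x| r)^(k + 1). The exponent k + 1 comes
  from \<open>gbinomial_half_le\<close>, and C \<ge> 1 pays for the additional power of C.\<close>

lemma majorant_sum_root_germ:
  assumes "r \<ge> 0" "c > 0" "c \<le> C" "C \<ge> 1" "m \<le> k"
  shows "majorant_sum r m (root_germ k c x) \<le> (C + \<bar>x\<bar> * r) ^ Suc k"
proof -
  have "majorant_sum r m (root_germ k c x) \<le> (\<Sum>s\<le>m. real (Suc k choose s) * (\<bar>x\<bar> * r) ^ s * C ^ (Suc k - s))"
    unfolding majorant_sum_def atMost_atLeast0
  proof (rule sum_mono)
    fix s assume "s \<in> {0..m}"
    then have s: "s \<le> k"
      using assms by simp
    have "\<bar>root_germ k c x $ s\<bar> * r ^ s = ((real k + 1/2) gchoose s) * (\<bar>x\<bar> * r) ^ s * c ^ (k - s)"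
      using s gbinomial_half_le[of s k] assms(2)
      by (simp add: root_germ_def abs_mult power_abs power_divide power_diff power_mult_distrib)
    also have "\<dots> \<le> real (Suc k choose s) * (\<bar>x\<bar> * r) ^ s * C ^ (Suc k - s)"
    proof (intro mult_mono)
      have "c ^ (k - s) \<le> C ^ (k - s)"
        using assms by (intro power_mono) auto
      also have "\<dots> \<le> C ^ (Suc k - s)"
        using assms s by (intro power_increasing) auto
      finally show "c ^ (k - s) \<le> C ^ (Suc k - s)" .
    qed (use s gbinomial_half_le[of s k] assms in auto)
    finally show "\<bar>root_germ k c x $ s\<bar> * r ^ s \<le> real (Suc k choose s) * (\<bar>x\<bar> * r) ^ s * C ^ (Suc k - s)" .
  qed
  also have "\<dots> \<le> (\<Sum>s\<le>Suc k. real (Suc k choose s) * (\<bar>x\<bar> * r) ^ s * C ^ (Suc k - s))"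
    using assms by (intro sum_mono2) auto
  also have "\<dots> = (C + \<bar>x\<bar> * r) ^ Suc k"
    using binomial_ring[of "\<bar>x\<bar> * r" C "Suc k"] by (simp add: add.commute)
  finally show ?thesis .
qed

text \<open>A coefficient estimate at radius 1/2, which is at most half the distance from a_j to any
  other node; the factor 2 inside the power is the inverse radius.\<close>

lemma pade_coeff_bound:
  fixes a :: "'n::finite \<Rightarrow> real"
  assumes gap: "\<And>l. l \<noteq> j \<Longrightarrow> \<bar>a j - a l\<bar> \<ge> 1" and M: "\<bar>a j\<bar> \<le> M" "M * \<bar>x\<bar> < 1"
  defines "w \<equiv> 1 + (M + 1/2) * \<bar>x\<bar>"
  shows "\<bar>pade_coeff a x k i j\<bar> \<le> w * (2 * w / (\<Prod>l\<in>-{j}. \<bar>a j - a l\<bar> - 1/2)) ^ k"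
proof (cases "pade_orders k i j")
  case 0
  have "0 \<le> w"
    using M by (simp add: w_def)
  moreover have "0 \<le> (\<Prod>l\<in>-{j}. \<bar>a j - a l\<bar> - 1/2)"
    by (intro prod_nonneg) (use gap in fastforce)
  ultimately show ?thesis
    using 0 by (simp add: pade_coeff_def local_residue_def)
next
  case (Suc m)
  define n where "n = pade_orders k i"
  define c where "c = 1 + a j * x"
  define e where "e = (\<lambda>l. inverse (\<bar>a j - a l\<bar> - 1/2))"
  have e: "0 < e l" "e l \<le> 2" if "l \<noteq> j" for l
  proof -
    have *: "\<bar>a j - a l\<bar> - 1/2 \<ge> 1/2"
      using gap[OF that] by simp
    then show "0 < e l"
      by (simp add: e_def)
    from * show "e l \<le> 2"
      using le_imp_inverse_le[of "1/2" "\<bar>a j - a l\<bar> - 1/2"] by (simp add: e_def)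
  qed
  have "\<bar>a j * x\<bar> \<le> M * \<bar>x\<bar>"
    using M(1) by (simp add: abs_mult mult_right_mono)
  then have c: "c > 0" "c \<le> 1 + M * \<bar>x\<bar>"
    using M(2) by (auto simp: c_def abs_le_iff)
  have M0: "M * \<bar>x\<bar> \<ge> 0"
    using M(1) by simp
  have w: "w > 0"
    using M0 by (simp add: w_def distrib_right add_pos_nonneg)
  have m: "m \<le> k"
    using Suc by (auto simp: pade_orders_def split: if_splits)
  have "pade_coeff a x k i j = (root_germ k c x * local_cofactor a n j) $ m"
    using Suc by (simp add: pade_coeff_def local_residue_def n_def c_def)
  then have "\<bar>pade_coeff a x k i j\<bar> * (1/2) ^ m \<le> majorant_sum (1/2) m (root_germ k c x * local_cofactor a n j)"
    unfolding majorant_sum_def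
    using member_le_sum[of m "{0..m}" "\<lambda>u. \<bar>(root_germ k c x * local_cofactor a n j) $ u\<bar> * (1/2) ^ u"]
    by simp
  also have "\<dots> \<le> majorant_sum (1/2) m (root_germ k c x) * majorant_sum (1/2) m (local_cofactor a n j)"
    by (rule majorant_sum_mult) simp
  also have "\<dots> \<le> w ^ Suc k * (\<Prod>l\<in>-{j}. e l ^ n l)"
  proof (intro mult_mono)
    show "majorant_sum (1/2) m (root_germ k c x) \<le> w ^ Suc k"
      using majorant_sum_root_germ[of "1/2" c "1 + M * \<bar>x\<bar>" m k x] c m M0
      by (simp add: w_def algebra_simps)
    show "majorant_sum (1/2) m (local_cofactor a n j) \<le> (\<Prod>l\<in>-{j}. e l ^ n l)"
      unfolding local_cofactor_def e_def
    proof (intro majorant_sum_prod majorant_sum_power majorant_sum_inverse_linear)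
      show "1/2 < \<bar>a j - a l\<bar>" if "l \<in> - {j}" for l
        using gap[of l] that by auto
    qed auto
  qed (use w in \<open>auto intro: majorant_sum_nonneg\<close>)
  finally have bound: "\<bar>pade_coeff a x k i j\<bar> \<le> w ^ Suc k * (2 ^ m * (\<Prod>l\<in>-{j}. e l ^ n l))"
    by (simp add: power_one_over field_simps)
  \<comment> \<open>For i = j both sides agree. Otherwise m = k - 1, and the additional factor e_i
    \<le> 2 is matched by the missing power of 2.\<close>
  have "2 ^ m * (\<Prod>l\<in>-{j}. e l ^ n l) \<le> 2 ^ k * (\<Prod>l\<in>-{j}. e l) ^ k"
  proof (cases "i = j")
    case True
    then have "m = k"
      using Suc by (simp add: pade_orders_def)
    moreover have "(\<Prod>l\<in>-{j}. e l ^ n l) = (\<Prod>l\<in>-{j}. e l ^ k)"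
      using True by (intro prod.cong) (auto simp: n_def pade_orders_def)
    ultimately show ?thesis
      by (simp add: prod_power_distrib)
  next
    case False
    then have k: "k = Suc m"
      using Suc by (simp add: pade_orders_def)
    have "(\<Prod>l\<in>-{j}. e l ^ n l) = e i ^ Suc k * (\<Prod>l\<in>-{j}-{i}. e l ^ n l)"
      using False by (subst prod.remove[of _ i]) (auto simp: n_def pade_orders_def)
    also have "(\<Prod>l\<in>-{j}-{i}. e l ^ n l) = (\<Prod>l\<in>-{j}-{i}. e l ^ k)"
      by (intro prod.cong) (auto simp: n_def pade_orders_def)
    also have "e i ^ Suc k * (\<Prod>l\<in>-{j}-{i}. e l ^ k) = e i * (\<Prod>l\<in>-{j}. e l) ^ k"
      using False by (subst (2) prod.remove[of _ i]) (auto simp: prod_power_distrib power_mult_distrib)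
    finally have "2 ^ m * (\<Prod>l\<in>-{j}. e l ^ n l) = 2 ^ m * (e i * (\<Prod>l\<in>-{j}. e l) ^ k)"
      by simp
    also have "\<dots> \<le> 2 ^ m * (2 * (\<Prod>l\<in>-{j}. e l) ^ k)"
      using e(2)[OF False] e(1) by (intro mult_left_mono mult_right_mono zero_le_power prod_nonneg) (auto intro: less_imp_le)
    finally show ?thesis
      by (simp add: k)
  qed
  with bound have "\<bar>pade_coeff a x k i j\<bar> \<le> w ^ Suc k * (2 ^ k * (\<Prod>l\<in>-{j}. e l) ^ k)"
    using w by (meson order.trans mult_left_mono zero_le_power less_imp_le)
  also have "\<dots> = w * (2 * w / (\<Prod>l\<in>-{j}. \<bar>a j - a l\<bar> - 1/2)) ^ k"
  proof -
    have "(\<Prod>l\<in>-{j}. e l) = inverse (\<Prod>l\<in>-{j}. \<bar>a j - a l\<bar> - 1/2)"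
      unfolding e_def using prod_inversef[of "\<lambda>l. \<bar>a j - a l\<bar> - 1/2" "-{j}"]
      unfolding comp_def .
    then show ?thesis
      by (simp only: power_mult_distrib divide_inverse power_Suc mult_ac)
  qed
  finally show ?thesis .
qed

section \<open>From linear forms to simultaneous approximation\<close>

text \<open>Take the least k with L^k \<ge> 2q. A form that is nonzero at \<open>v\<close> has an
  integer value there; replacing v by q \<theta> accounts for at most 1/2 of it, so the errors v_j -
  q \<theta>_j, with coefficients of size C P^k, must supply the rest.\<close>

lemma simultaneous_approximation_bound:
  fixes \<theta> v :: "'n::finite \<Rightarrow> real" and p :: "nat \<Rightarrow> 'n \<Rightarrow> 'n \<Rightarrow> real"
  assumes p_int: "\<And>k i j. p k i j \<in> \<int>"
    and p_bound: "\<And>k i j. \<bar>p k i j\<bar> \<le> C * P ^ k"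
    and p_form: "\<And>k i. k \<ge> 1 \<Longrightarrow> \<bar>\<Sum>j\<in>UNIV. p k i j * \<theta> j\<bar> \<le> 1 / L ^ k"
    and nonsing: "\<And>k. \<exists>i. (\<Sum>j\<in>UNIV. p k i j * v j) \<noteq> 0"
    and "L > 1" "P \<ge> 1" "C \<ge> 0"
    and v_int: "\<And>j. v j \<in> \<int>" and "\<theta> j0 = 1" and "v j0 = q" and "q \<ge> 1"
    and close: "\<And>j. \<bar>\<theta> j - v j / q\<bar> \<le> \<delta>"
  shows "1 \<le> 2 * real (CARD('n) - 1) * C * P * q * (2 * q) powr (ln P / ln L) * \<delta>"
proof -
  define k where "k = (LEAST k. 2 * q \<le> L ^ k)"
  obtain k' where "2 * q < L ^ k'"
    using real_arch_pow[OF \<open>L > 1\<close>] by blast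
  then have Lk: "2 * q \<le> L ^ k"
    unfolding k_def by (rule LeastI[OF less_imp_le])
  have "k \<noteq> 0"
    using Lk \<open>q \<ge> 1\<close> by (intro notI) simp
  then obtain m where m: "k = Suc m"
    using not0_implies_Suc by blast
  have Lm: "L ^ m < 2 * q"
    using not_less_Least[of m "\<lambda>k. 2 * q \<le> L ^ k"] m unfolding k_def[symmetric] by simp
  define e where "e = ln P / ln L"
  have e: "e \<ge> 0"
    using \<open>L > 1\<close> \<open>P \<ge> 1\<close> by (simp add: e_def)
  \<comment> \<open>Minimality of k gives L^(k - 1) < 2q, which bounds P^(k - 1) by a power of
    2q.\<close>
  have "P ^ m = (L ^ m) powr e"
  proof -
    have "L powr e = P"
      using \<open>L > 1\<close> \<open>P \<ge> 1\<close> by (simp add: e_def powr_def)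
    then have "P ^ m = (L powr e) powr real m"
      using \<open>P \<ge> 1\<close> by (simp add: powr_realpow)
    also have "\<dots> = (L powr real m) powr e"
      by (simp only: powr_powr mult.commute)
    finally show ?thesis
      using \<open>L > 1\<close> by (simp add: powr_realpow)
  qed
  also have "\<dots> \<le> (2 * q) powr e"
    using Lm \<open>L > 1\<close> e by (intro powr_mono2) auto
  finally have Pk: "P ^ k \<le> P * (2 * q) powr e"
    using \<open>P \<ge> 1\<close> by (simp add: m)
  obtain i where i: "(\<Sum>j\<in>UNIV. p k i j * v j) \<noteq> 0"
    using nonsing by blast
  have "(\<Sum>j\<in>UNIV. p k i j * v j) \<in> \<int>"
    using p_int v_int by (intro Ints_sum Ints_mult)
  then have "1 \<le> \<bar>\<Sum>j\<in>UNIV. p k i j * v j\<bar>"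
    using i by (rule Ints_nonzero_abs_ge1)
  also have "(\<Sum>j\<in>UNIV. p k i j * v j)
      = q * (\<Sum>j\<in>UNIV. p k i j * \<theta> j) + (\<Sum>j\<in>UNIV. p k i j * (v j - q * \<theta> j))"
    by (simp add: sum_distrib_left algebra_simps sum_subtractf sum.distrib)
  also have "\<bar>\<dots>\<bar> \<le> q * (1 / L ^ k) + \<bar>\<Sum>j\<in>UNIV. p k i j * (v j - q * \<theta> j)\<bar>"
    using mult_left_mono[OF p_form[of k i], of q] \<open>k \<noteq> 0\<close> \<open>q \<ge> 1\<close>
    by (intro order.trans[OF abs_triangle_ineq] add_right_mono) (simp add: abs_mult)
  also have "q * (1 / L ^ k) \<le> 1 / 2"
    using Lk \<open>L > 1\<close> by (simp add: divide_simps)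
  also have "\<bar>\<Sum>j\<in>UNIV. p k i j * (v j - q * \<theta> j)\<bar> \<le> (\<Sum>j\<in>UNIV-{j0}. (C * P ^ k) * (q * \<delta>))"
  proof -
    \<comment> \<open>The index \<open>j0\<close> carries no error, which leaves one summand fewer
      than there are nodes.\<close>
    have "(\<Sum>j\<in>UNIV. p k i j * (v j - q * \<theta> j)) = (\<Sum>j\<in>UNIV-{j0}. p k i j * (v j - q * \<theta> j))"
      using \<open>\<theta> j0 = 1\<close> \<open>v j0 = q\<close> by (subst sum.remove[of _ j0]) auto
    also have "\<bar>\<dots>\<bar> \<le> (\<Sum>j\<in>UNIV-{j0}. \<bar>p k i j * (v j - q * \<theta> j)\<bar>)"
      by (rule sum_abs)
    also have "\<dots> \<le> (\<Sum>j\<in>UNIV-{j0}. (C * P ^ k) * (q * \<delta>))"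
    proof (intro sum_mono)
      fix j
      have "v j - q * \<theta> j = - (q * (\<theta> j - v j / q))"
        using \<open>q \<ge> 1\<close> by (simp add: algebra_simps)
      then have "\<bar>v j - q * \<theta> j\<bar> \<le> q * \<delta>"
        using close[of j] \<open>q \<ge> 1\<close> by (simp add: abs_mult mult_left_mono del: minus_mult_right minus_diff_eq)
      then show "\<bar>p k i j * (v j - q * \<theta> j)\<bar> \<le> (C * P ^ k) * (q * \<delta>)"
        unfolding abs_mult using p_bound[of k i j] \<open>C \<ge> 0\<close> \<open>P \<ge> 1\<close> by (intro mult_mono) auto
    qed
    finally show ?thesis .
  qed
  finally have "1 \<le> 1/2 + real (CARD('n) - 1) * (C * P ^ k * (q * \<delta>))"
    by simp
  then have "1 \<le> 2 * (real (CARD('n) - 1) * (C * P ^ k * (q * \<delta>)))"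
    by linarith
  then have "1 \<le> 2 * real (CARD('n) - 1) * C * P ^ k * (q * \<delta>)"
    by (simp only: mult.assoc)
  also have "\<dots> \<le> 2 * real (CARD('n) - 1) * C * (P * (2 * q) powr e) * (q * \<delta>)"
  proof (intro mult_right_mono mult_left_mono Pk)
    show "0 \<le> q * \<delta>"
      using close[of j0] \<open>q \<ge> 1\<close> by (intro mult_nonneg_nonneg) linarith+
  qed (use \<open>C \<ge> 0\<close> in auto)
  finally show ?thesis
    by (simp add: e_def mult_ac)
qed

text \<open>Adding ln c above and 2 ln c below forms a mediant with 1/2, and 1/2 \<le> ln P / ln L,
  so the quotient cannot grow.\<close>

lemma ln_ratio_le:
  fixes P L c L' :: real
  assumes "1 < P" "1 < L" "L \<le> P\<^sup>2" "1 \<le> c" "c\<^sup>2 * L \<le> L'"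
  shows "ln (c * P) / ln L' \<le> ln P / ln L"
proof -
  have pos: "ln c \<ge> 0" "ln P > 0" "ln L > 0"
    by (rule ln_ge_zero[OF assms(4)], rule ln_gt_zero[OF assms(1)], rule ln_gt_zero[OF assms(2)])
  have "ln L \<le> ln (P\<^sup>2)"
    using assms by (subst ln_le_cancel_iff) auto
  then have L: "ln L \<le> 2 * ln P"
    using assms by (simp add: ln_realpow)
  have "2 * ln c + ln L = ln (c\<^sup>2 * L)"
    using assms by (simp add: ln_mult ln_realpow)
  also have "\<dots> \<le> ln L'"
    using assms by (intro ln_mono) auto
  finally have L': "2 * ln c + ln L \<le> ln L'" .
  have "ln (c * P) / ln L' = (ln c + ln P) / ln L'"
    using assms by (simp add: ln_mult)
  also have "\<dots> \<le> (ln c + ln P) / (2 * ln c + ln L)"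
    using L' pos by (intro divide_left_mono mult_pos_pos) auto
  also have "\<dots> \<le> ln P / ln L"
    using mult_left_mono[OF L pos(1)] pos by (simp add: divide_simps algebra_simps)
  finally show ?thesis .
qed

section \<open>The three nodes\<close>

text \<open>Applied with \<open>e\<close> the absolute value of \<epsilon>. The first bound keeps (A
  + 1)|x| at most 1/170; the second makes the exponent \<lambda> less than 2.\<close>

lemma N_lower_bounds:
  fixes A K e N :: real
  assumes K: "K \<ge> 30.03 * e ^ 3 * (A + 1)" and cases: "A \<ge> 3 \<and> e \<ge> 1 \<or> A = 2 \<and> e = 2"
    and N: "N \<ge> (A\<^sup>2 + A) * K / 2 - e * A"
  shows "N \<ge> 170 * (e * (A + 1))" and "20 * (A + 1) * N < 1.338 * N\<^sup>2 / (e ^ 3 * A * (A + 1))"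
proof -
  have A: "A \<ge> 2" and e: "e \<ge> 1" and eA: "e * (A + 1) \<ge> 4"
    using cases by (auto intro: order.trans[OF _ mult_mono[of 1 e 4 "A + 1"]])
  have "(A\<^sup>2 + A) / 2 * (30.03 * e ^ 3 * (A + 1)) \<le> (A\<^sup>2 + A) / 2 * K"
    using K A by (intro mult_left_mono) auto
  then have N1: "N \<ge> e * A * (15.015 * (e * (A + 1))\<^sup>2 - 1)"
  proof -
    have "(A\<^sup>2 + A) / 2 * (30.03 * e ^ 3 * (A + 1)) - e * A = e * A * (15.015 * (e * (A + 1))\<^sup>2 - 1)"
      by (simp add: power2_eq_square power3_eq_cube field_simps)
    moreover have "(A\<^sup>2 + A) / 2 * K = (A\<^sup>2 + A) * K / 2"
      by simp
    ultimately show ?thesis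
      using N \<open>(A\<^sup>2 + A) / 2 * (30.03 * e ^ 3 * (A + 1)) \<le> (A\<^sup>2 + A) / 2 * K\<close> by linarith
  qed
  show N2: "N \<ge> 170 * (e * (A + 1))"
    using cases
  proof
    assume *: "A \<ge> 3 \<and> e \<ge> 1"
    have "60 * (A + 1) \<le> 15 * (e * (A + 1))\<^sup>2"
    proof -
      have "4 * (e * (A + 1)) \<le> (e * (A + 1))\<^sup>2"
        unfolding power2_eq_square using eA by (intro mult_right_mono) auto
      moreover have "1 * (A + 1) \<le> e * (A + 1)"
        using e A by (intro mult_right_mono) auto
      ultimately show ?thesis
        by simp
    qed
    then have "15.015 * (e * (A + 1))\<^sup>2 - 1 \<ge> 60 * (A + 1) - 1"
    proof -
      have "15.015 * z = 15 * z + 15/1000 * z" for z :: real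
        by simp
      moreover have "15/1000 * (e * (A + 1))\<^sup>2 \<ge> 0"
        by simp
      ultimately have "15 * (e * (A + 1))\<^sup>2 \<le> 15.015 * (e * (A + 1))\<^sup>2"
        by (metis le_add_same_cancel1)
      then show ?thesis
        using \<open>60 * (A + 1) \<le> 15 * (e * (A + 1))\<^sup>2\<close> by (meson diff_right_mono order.trans)
    qed
    then have "e * (A * (60 * (A + 1) - 1)) \<le> e * (A * (15.015 * (e * (A + 1))\<^sup>2 - 1))"
      using e A by (intro mult_left_mono) auto
    moreover have "170 * (A + 1) \<le> A * (60 * (A + 1) - 1)"
      using * mult_right_mono[of 3 A "60 * (A + 1) - 1"] by auto
    then have "e * (170 * (A + 1)) \<le> e * (A * (60 * (A + 1) - 1))"
      using e by (intro mult_left_mono) auto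
    ultimately show ?thesis
      using N1 by (simp add: mult_ac)
  next
    assume "A = 2 \<and> e = 2"
    then show ?thesis
      using N1 by simp
  qed
  have "N > 0"
    using N2 eA by linarith
  \<comment> \<open>The product 1.338 * 15.015 exceeds 20 by about 0.09; times 16 this surplus
    outweighs the 1.338 lost to the term -1.\<close>
  have "16 \<le> (e * (A + 1))\<^sup>2"
    using power_mono[OF eA, of 2] by simp
  then have "e * A * (20 * (e * (A + 1))\<^sup>2) < e * A * (1.338 * (15.015 * (e * (A + 1))\<^sup>2 - 1))"
    using e A by (intro mult_strict_left_mono) auto
  also have "\<dots> = 1.338 * (e * A * (15.015 * (e * (A + 1))\<^sup>2 - 1))"
    by (simp only: mult_ac)
  also have "\<dots> \<le> 1.338 * N"
    using N1 by (rule mult_left_mono) simp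
  finally have "20 * (e ^ 3 * A * (A + 1) * (A + 1)) < 1.338 * N"
    by (simp add: power2_eq_square power3_eq_cube mult_ac)
  then have "20 * (e ^ 3 * A * (A + 1) * (A + 1)) * N < 1.338 * N * N"
    using \<open>N > 0\<close> by (rule mult_strict_right_mono)
  moreover have "e ^ 3 * A * (A + 1) > 0"
    using e A by simp
  ultimately show "20 * (A + 1) * N < 1.338 * N\<^sup>2 / (e ^ 3 * A * (A + 1))"
    by (simp only: pos_less_divide_eq power2_eq_square mult_ac)
qed

text \<open>Index 2 carries the node 0, whose square root is 1; it is paired with the denominator
  q.\<close>

definition nodes :: "real \<Rightarrow> 3 \<Rightarrow> real" where
  "nodes A = (\<lambda>i. if i = 1 then - A else if i = 2 then 0 else 1)"

lemma nodes_simps [simp]: "nodes A 1 = - A" "nodes A 2 = 0" "nodes A 3 = 1"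
  by (simp_all add: nodes_def)

lemma Compl_3: "- {1::3} = {2, 3}" "- {2::3} = {1, 3}" "- {3::3} = {1, 2}"
  using exhaust_3 by auto

lemma inj_nodes: "A > 0 \<Longrightarrow> inj (nodes A)"
  unfolding inj_def forall_3 by auto

text \<open>The exponent is -2k + 1/2, and for y \<le> 1 dropping the 1/2 only enlarges the
  power.\<close>

lemma powr_half_minus_le:
  assumes "0 < y" "y \<le> (1::real)" "k \<ge> 1"
  shows "y powr (real k + 1/2 - real (3 * k)) \<le> (1 / y\<^sup>2) ^ k"
proof -
  have "y powr (real k + 1/2 - real (3 * k)) \<le> y powr - real (2 * k)"
    using assms by (intro powr_mono') auto
  also have "\<dots> = (1 / y\<^sup>2) ^ k"
    using assms by (simp add: powr_minus powr_realpow power_mult power_divide divide_inverse power_inverse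
        del: of_nat_mult)
  finally show ?thesis .
qed

text \<open>The general bound for the nodes -A, 0, 1 with C = 2; the constant is 172 = 2 * 2 * 2 *
  21.5.\<close>

lemma sqrt_pair_approximation:
  fixes A K \<epsilon> :: int and N \<delta> q p1 p2 :: real
  defines "e \<equiv> \<bar>real_of_int \<epsilon>\<bar>"
  assumes "A \<ge> 2" and "\<epsilon> \<noteq> 0"
    and N: "N = (real_of_int A ^ 2 + real_of_int A) * real_of_int K / 2 + real_of_int \<epsilon> * real_of_int A"
    and big: "N \<ge> 170 * (e * (real_of_int A + 1))"
    and "1 < 1.6 * N\<^sup>2 / (e ^ 3 * real_of_int A * (real_of_int A + 1))"
    and "q \<in> \<int>" "q \<ge> 1" "p1 \<in> \<int>" "p2 \<in> \<int>"
    and "\<bar>sqrt (1 - real_of_int \<epsilon> * real_of_int A / N) - p1 / q\<bar> \<le> \<delta>"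
    and "\<bar>sqrt (1 + real_of_int \<epsilon> / N) - p2 / q\<bar> \<le> \<delta>"
  shows "1 \<le> 172 * (real_of_int A + 1) * N * q
    * (2 * q) powr (ln (21.5 * (real_of_int A + 1) * N) / ln (1.6 * N\<^sup>2 / (e ^ 3 * real_of_int A * (real_of_int A + 1))))
    * \<delta>"
proof -
  define B where "B = real_of_int A"
  define \<eta> where "\<eta> = real_of_int \<epsilon>"
  define a where "a = nodes B"
  define x where "x = \<eta> / N"
  define H where "H = B * (B + 1)"
  define P where "P = 21.5 * (B + 1) * N"
  define L where "L = 1.6 * N\<^sup>2 / (e ^ 3 * H)"
  define p where "p = (\<lambda>k i j. (4 * N * H) ^ k * pade_coeff a x k i j)"
  define \<theta> where "\<theta> = (\<lambda>j. sqrt (1 + a j * x))"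
  define v :: "3 \<Rightarrow> real" where "v = (\<lambda>j. if j = 1 then p1 else if j = 2 then q else p2)"
  have B: "B \<ge> 2"
    using \<open>A \<ge> 2\<close> by (simp add: B_def)
  have e1: "e \<ge> 1"
    using \<open>\<epsilon> \<noteq> 0\<close> by (simp add: e_def)
  have e\<eta>: "e = \<bar>\<eta>\<bar>"
    by (simp add: e_def \<eta>_def)
  have big: "N \<ge> 170 * (e * (B + 1))"
    using big by (simp add: B_def)
  moreover have "1 * 1 \<le> e * (B + 1)"
    using e1 B by (intro mult_mono) auto
  ultimately have Npos: "N > 0" "N \<ge> 1"
    by linarith+
  have H: "H > 0"
    using B by (simp add: H_def)
  have absx: "\<bar>x\<bar> = e / N"
    using Npos by (simp add: x_def e\<eta>)
  have Bx: "(B + 1) * \<bar>x\<bar> \<le> 1/170"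
    unfolding absx using big Npos by (simp add: divide_simps mult.commute)
  have Bx': "B * \<bar>x\<bar> \<le> 1/170" "(B + 1/2) * \<bar>x\<bar> \<le> 1/170"
    using Bx by (simp_all add: distrib_right)
  have x: "x \<noteq> 0"
    using \<open>\<epsilon> \<noteq> 0\<close> Npos by (simp add: x_def \<eta>_def)
  have inj: "inj a"
    using B by (simp add: a_def inj_nodes)
  have aB: "\<bar>a l\<bar> \<le> B" for l
    using B exhaust_3[of l] by (auto simp: a_def)
  have ax: "\<bar>a l * x\<bar> \<le> 1/170" for l
    using mult_right_mono[OF aB[of l], of "\<bar>x\<bar>"] Bx'(1) by (simp add: abs_mult)
  have cpos: "1 + a l * x > 0" for l
    using ax[of l] by (simp add: abs_le_iff)
  have "1 \<le> 2 * real (CARD(3) - 1) * 2 * P * q * (2 * q) powr (ln P / ln L) * \<delta>"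
  proof (rule simultaneous_approximation_bound[of p 2 P \<theta> L v])
    show "p k i j \<in> \<int>" for k i j
      unfolding p_def x_def
    \<comment> \<open>The products of node differences are A (A + 1), -A and A + 1. Since 2N = A (A
      + 1) K + 2 \<epsilon> A, each divides 2 (N + a_j \<epsilon>), with quotient
      \<open>\<mu>\<close>.\<close>
    proof (rule pade_coeff_Ints[OF inj, where \<mu> = "if j = 1 then real_of_int K else if j = 2
          then - real_of_int ((A + 1) * K + 2 * \<epsilon>) else real_of_int (A * K + 2 * \<epsilon>)"
          and \<nu> = "if j = 1 then 1 else if j = 2 then - real_of_int (A + 1) else real_of_int A"])
      show "a l \<in> \<int>" for l
        using exhaust_3[of l] by (auto simp: a_def B_def)
      have "N * (1 + a j * x) \<noteq> 0"
        using cpos[of j] Npos by simp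
      then show "N + a j * \<eta> \<noteq> 0"
        using Npos by (simp add: x_def algebra_simps)
      show "2 * (N + a j * \<eta>) = (\<Prod>l\<in>-{j}. a j - a l) * (if j = 1 then real_of_int K else if j = 2
          then - real_of_int ((A + 1) * K + 2 * \<epsilon>) else real_of_int (A * K + 2 * \<epsilon>))"
        using exhaust_3[of j]
        by (auto simp: a_def Compl_3 B_def \<eta>_def N power2_eq_square algebra_simps)
      show "H = (\<Prod>l\<in>-{j}. a j - a l) * (if j = 1 then 1 else if j = 2 then - real_of_int (A + 1) else real_of_int A)"
        using exhaust_3[of j] by (auto simp: a_def Compl_3 B_def H_def algebra_simps)
    qed (use Npos in \<open>auto simp: \<eta>_def\<close>)
  next
    fix k i j
    define w where "w = 1 + (B + 1/2) * \<bar>x\<bar>"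
    define G where "G = (\<Prod>l\<in>-{j}. \<bar>a j - a l\<bar> - 1/2)"
    have w: "1 \<le> w" "w \<le> 171/170"
      using Bx'(2) B by (simp_all add: w_def)
    \<comment> \<open>The smallest value occurs at the node 0, with factors B - 1/2 and 1/2.\<close>
    have G: "G \<ge> (B - 1/2) / 2"
    proof -
      have "(B - 1/2) * (1/2) \<le> (B - 1/2) * (B + 1/2)"
        using B by (intro mult_left_mono) auto
      then show ?thesis
        using exhaust_3[of j] B unfolding G_def
        by (auto simp: a_def Compl_3 algebra_simps)
    qed
    moreover have "(B - 1/2) / 2 > 0"
      using B by simp
    ultimately have Gpos: "G > 0"
      by (rule less_le_trans[rotated])
    \<comment> \<open>The cleared coefficients grow at the rate 8 w B (B + 1) N / G; the constant
      21.5 is nearly sharp at B = 2.\<close>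
    have "8 * w * B \<le> 21.5 * G"
    proof -
      have "8 * w * B \<le> 8 * (171/170) * B"
        using w B by (intro mult_right_mono mult_left_mono) auto
      also have "\<dots> \<le> 21.5 * ((B - 1/2) / 2)"
        using B by simp
      finally show ?thesis
        using G by simp
    qed
    then have "(8 * w * B) * ((B + 1) * N) \<le> (21.5 * G) * ((B + 1) * N)"
      using B Npos by (intro mult_right_mono) auto
    then have "4 * N * H * (2 * w / G) \<le> P"
      using Gpos by (simp add: H_def P_def divide_simps mult_ac)
    moreover have "0 \<le> 4 * N * H * (2 * w / G)"
      using Npos H w Gpos by simp
    ultimately have pow: "(4 * N * H * (2 * w / G)) ^ k \<le> P ^ k"
      by (rule power_mono)
    have "\<bar>pade_coeff a x k i j\<bar> \<le> w * (2 * w / G) ^ k"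
      unfolding w_def G_def
    proof (rule pade_coeff_bound)
      show "1 \<le> \<bar>a j - a l\<bar>" if "l \<noteq> j" for l
        using that B exhaust_3[of j] exhaust_3[of l] by (auto simp: a_def)
    qed (use aB Bx' in auto)
    then have "\<bar>p k i j\<bar> \<le> (4 * N * H) ^ k * (w * (2 * w / G) ^ k)"
      unfolding p_def abs_mult using Npos H by (intro mult_mono) auto
    also have "\<dots> = w * (4 * N * H * (2 * w / G)) ^ k"
      by (simp only: power_mult_distrib mult_ac)
    also have "\<dots> \<le> 2 * P ^ k"
      using w pow \<open>0 \<le> 4 * N * H * (2 * w / G)\<close> by (intro mult_mono) auto
    finally show "\<bar>p k i j\<bar> \<le> 2 * P ^ k" .
  next
    fix k :: nat and i :: 3
    assume k: "k \<ge> 1"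
    have y: "0 < 1 - B * \<bar>x\<bar>" "1 - B * \<bar>x\<bar> \<le> 1" "1 - B * \<bar>x\<bar> \<ge> 169/170"
      using Bx'(1) B by auto
    have "\<bar>\<Sum>j\<in>UNIV. \<theta> j * pade_coeff a x k i j\<bar>
        \<le> \<bar>(real k + 1/2) gchoose (3 * k)\<bar> * \<bar>x\<bar> ^ (3 * k) * (1 - B * \<bar>x\<bar>) powr (real k + 1/2 - real (3 * k))"
      unfolding \<theta>_def pade_coeff_def
    proof (rule linear_form_bound[OF inj aB])
      show "sum (pade_orders k i) UNIV = Suc (3 * k)"
        by (simp add: sum_pade_orders)
    qed (use y k in auto)
    also have "\<dots> \<le> (4/27) ^ k * \<bar>x\<bar> ^ (3 * k) * (1 / (1 - B * \<bar>x\<bar>)\<^sup>2) ^ k"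
      using y k by (intro mult_mono abs_gbinomial_le powr_half_minus_le) auto
    also have "\<dots> \<le> (4/27) ^ k * \<bar>x\<bar> ^ (3 * k) * (170/169) ^ (2 * k)"
    proof (intro mult_left_mono)
      have "1 / (1 - B * \<bar>x\<bar>) \<le> 170/169"
        using y by (simp add: divide_simps)
      then have "(1 / (1 - B * \<bar>x\<bar>)) ^ (2 * k) \<le> (170/169) ^ (2 * k)"
        using y by (intro power_mono) auto
      then show "(1 / (1 - B * \<bar>x\<bar>)\<^sup>2) ^ k \<le> (170/169) ^ (2 * k)"
        by (simp add: power_mult power_divide)
    qed auto
    finally have form: "\<bar>\<Sum>j\<in>UNIV. \<theta> j * pade_coeff a x k i j\<bar>
        \<le> (4/27) ^ k * \<bar>x\<bar> ^ (3 * k) * (170/169) ^ (2 * k)" .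
    have "(\<Sum>j\<in>UNIV. p k i j * \<theta> j) = (4 * N * H) ^ k * (\<Sum>j\<in>UNIV. \<theta> j * pade_coeff a x k i j)"
      by (simp add: p_def sum_distrib_left mult_ac)
    then have "\<bar>\<Sum>j\<in>UNIV. p k i j * \<theta> j\<bar> = (4 * N * H) ^ k * \<bar>\<Sum>j\<in>UNIV. \<theta> j * pade_coeff a x k i j\<bar>"
      using Npos H by (simp add: abs_mult)
    also have "\<dots> \<le> (4 * N * H) ^ k * ((4/27) ^ k * \<bar>x\<bar> ^ (3 * k) * (170/169) ^ (2 * k))"
      using form Npos H by (intro mult_left_mono) auto
    also have "\<dots> = (4 * N * H * (4/27) * \<bar>x\<bar> ^ 3 * (170/169)\<^sup>2) ^ k"
      unfolding power_mult power_mult_distrib by (simp only: mult_ac)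
    also have "\<dots> \<le> (1 / L) ^ k"
    proof (rule power_mono)
      \<comment> \<open>The number 16/27 (170/169)^2 is about 0.5996, below 1/1.6 = 0.625.\<close>
      have "4 * N * H * (4/27) * \<bar>x\<bar> ^ 3 * (170/169)\<^sup>2 = (16/27 * (170/169)\<^sup>2) * (e ^ 3 * H / N\<^sup>2)"
        using Npos by (simp add: absx power_divide power2_eq_square power3_eq_cube)
      also have "\<dots> \<le> (1 / 1.6) * (e ^ 3 * H / N\<^sup>2)"
        using H e1 by (intro mult_right_mono) (simp_all add: power2_eq_square)
      also have "\<dots> = 1 / L"
        by (simp add: L_def)
      finally show "4 * N * H * (4/27) * \<bar>x\<bar> ^ 3 * (170/169)\<^sup>2 \<le> 1 / L" .
    qed (use Npos H in auto)
    finally show "\<bar>\<Sum>j\<in>UNIV. p k i j * \<theta> j\<bar> \<le> 1 / L ^ k"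
      by (simp add: power_divide)
  next
    fix k
    have "v 2 \<noteq> 0"
      using \<open>q \<ge> 1\<close> by (simp add: v_def)
    then obtain i where i: "(\<Sum>j\<in>UNIV. pade_coeff a x k i j * v j) \<noteq> 0"
      using pade_nonsingular[of a x v 2 k] inj x cpos by (metis less_irrefl)
    have "(\<Sum>j\<in>UNIV. p k i j * v j) = (4 * N * H) ^ k * (\<Sum>j\<in>UNIV. pade_coeff a x k i j * v j)"
      by (simp add: p_def sum_distrib_left mult_ac)
    then show "\<exists>i. (\<Sum>j\<in>UNIV. p k i j * v j) \<noteq> 0"
      using i Npos H by (intro exI[of _ i]) simp
  next
    show "1 < L"
      using assms by (simp add: L_def H_def B_def mult.assoc)
    have "1 * 1 \<le> (21.5 * (B + 1)) * N"
      using B Npos by (intro mult_mono) auto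
    then show "1 \<le> P"
      by (simp add: P_def)
    show "v j \<in> \<int>" for j
      using assms by (simp add: v_def)
    show "\<theta> 2 = 1" "v 2 = q"
      by (simp_all add: \<theta>_def a_def v_def)
    show "\<bar>\<theta> j - v j / q\<bar> \<le> \<delta>" for j
    proof -
      have "0 \<le> \<delta>"
        using assms(11) by linarith
      moreover have "\<theta> 1 = sqrt (1 - real_of_int \<epsilon> * real_of_int A / N)" "\<theta> 2 = 1"
        "\<theta> 3 = sqrt (1 + real_of_int \<epsilon> / N)"
        by (simp_all add: \<theta>_def a_def x_def B_def \<eta>_def mult.commute)
      moreover have "v 1 = p1" "v 2 = q" "v 3 = p2"
        by (simp_all add: v_def)
      ultimately show ?thesis
        using exhaust_3[of j] assms(11,12) \<open>q \<ge> 1\<close> by auto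
    qed
  qed (use \<open>q \<ge> 1\<close> in auto)
  moreover have "2 * real (CARD(3) - 1) * 2 * P = 172 * (B + 1) * N"
    by (simp add: P_def)
  ultimately have "1 \<le> 172 * (B + 1) * N * q * (2 * q) powr (ln P / ln L) * \<delta>"
    by (simp only:)
  then show ?thesis
    by (simp only: P_def L_def H_def B_def mult.assoc)
qed

section \<open>Comparison of the growth rates with the exponent \<lambda>\<close>

theorem theorem2p1:
  fixes \<epsilon> A K :: int and N \<theta>\<^sub>1 \<theta>\<^sub>2 lam :: real
  assumes "\<epsilon> \<in> {-2, -1, 1, 2}"
    and "real_of_int K \<ge> 30.03 * \<bar>real_of_int \<epsilon>\<bar> ^ 3 * (real_of_int A + 1)"
    and "A \<ge> 3 \<or> (A = 2 \<and> \<bar>\<epsilon>\<bar> = 2)"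
    and "N = (real_of_int A ^ 2 + real_of_int A) * real_of_int K / 2 + real_of_int \<epsilon> * real_of_int A"
    and "\<theta>\<^sub>1 = sqrt (1 - real_of_int \<epsilon> * real_of_int A / N)"
    and "\<theta>\<^sub>2 = sqrt (1 + real_of_int \<epsilon> / N)"
    and "lam = 1 + ln (20 * (real_of_int A + 1) * N) /
           ln (1.338 * N ^ 2 / (\<bar>real_of_int \<epsilon>\<bar> ^ 3 * real_of_int A * (real_of_int A + 1)))"
  shows "(\<forall>p\<^sub>1 p\<^sub>2 q :: int. q > 0 \<longrightarrow>
            max \<bar>\<theta>\<^sub>1 - real_of_int p\<^sub>1 / real_of_int q\<bar> \<bar>\<theta>\<^sub>2 - real_of_int p\<^sub>2 / real_of_int q\<bar>
              > inverse (2.838 * 10 ^ 28 * (real_of_int A + 1) * N) * real_of_int q powr (- lam))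
         \<and> lam < 2"
proof -
  define B where "B = real_of_int A"
  define e where "e = \<bar>real_of_int \<epsilon>\<bar>"
  define P where "P = 20 * (B + 1) * N"
  define L where "L = 1.338 * N\<^sup>2 / (e ^ 3 * B * (B + 1))"
  define L' where "L' = 1.6 * N\<^sup>2 / (e ^ 3 * B * (B + 1))"
  have cases: "B \<ge> 3 \<and> e \<ge> 1 \<or> B = 2 \<and> e = 2"
    using assms(1,3) by (auto simp: B_def e_def)
  then have B: "B \<ge> 2" and e: "e \<ge> 1"
    by auto
  have "- (e * B) \<le> real_of_int \<epsilon> * B"
    using B mult_right_mono[of "- e" "real_of_int \<epsilon>" B] by (simp add: e_def)
  then have "N \<ge> (B\<^sup>2 + B) * real_of_int K / 2 - e * B"
    using assms(4) by (simp add: B_def)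
  note bounds = N_lower_bounds[OF _ cases this]
  have big: "N \<ge> 170 * (e * (B + 1))" and "P < L"
    using bounds assms(2) by (simp_all add: P_def L_def B_def e_def)
  moreover have "1 * 1 \<le> e * (B + 1)"
    using e B by (intro mult_mono) auto
  ultimately have N: "N \<ge> 1"
    by linarith
  have "1 * 1 < (20 * (B + 1)) * N"
    using B N by (intro mult_less_le_imp_less) auto
  then have P: "P > 1"
    by (simp add: P_def)
  have D: "e ^ 3 * B * (B + 1) \<ge> 1"
  proof -
    have "1 \<le> e ^ 3"
      using e by simp
    moreover have "1 * 1 * 1 \<le> e ^ 3 * B * (B + 1)" if "1 \<le> e ^ 3"
      using that B e by (intro mult_mono) auto
    ultimately show ?thesis
      by simp
  qed
  have "L \<le> P\<^sup>2"
  proof -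
    have "L \<le> 1.338 * N\<^sup>2 / 1"
      unfolding L_def using D by (intro divide_left_mono) auto
    also have "\<dots> \<le> 20\<^sup>2 * N\<^sup>2"
      by simp
    also have "\<dots> \<le> (20 * (B + 1))\<^sup>2 * N\<^sup>2"
      using B by (intro mult_right_mono power_mono) auto
    finally show ?thesis
      by (simp add: P_def power_mult_distrib)
  qed
  \<comment> \<open>Here 1.075 = 21.5/20 is the quotient of the two rates P' and P, and 1.075^2 *
    1.338 is about 1.546.\<close>
  have LL': "1.075\<^sup>2 * L \<le> L'"
  proof -
    define y where "y = N\<^sup>2 / (e ^ 3 * B * (B + 1))"
    have "L = 1.338 * y" "L' = 1.6 * y"
      by (simp_all add: L_def L'_def y_def)
    moreover have "y \<ge> 0"
      using D unfolding y_def by (intro divide_nonneg_nonneg) auto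
    ultimately show ?thesis
      by (simp add: power2_eq_square)
  qed
  have lam: "lam = 1 + ln P / ln L"
    using assms(7) by (simp add: P_def L_def B_def e_def)
  have "ln P < ln L" "ln L > 0"
    using \<open>P < L\<close> P by simp_all
  then have "lam < 2"
    by (simp add: lam)
  have ratio: "ln (1.075 * P) / ln L' \<le> lam - 1"
    using ln_ratio_le[of P L "1.075" L'] P \<open>P < L\<close> \<open>L \<le> P\<^sup>2\<close> LL' by (simp add: lam)
  have "max \<bar>\<theta>\<^sub>1 - real_of_int p1 / real_of_int q\<bar> \<bar>\<theta>\<^sub>2 - real_of_int p2 / real_of_int q\<bar>
      > inverse (2.838 * 10 ^ 28 * (B + 1) * N) * real_of_int q powr (- lam)"
    if "q > 0" for p1 p2 q :: int
  proof (rule ccontr)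
    define \<delta> where "\<delta> = inverse (2.838 * 10 ^ 28 * (B + 1) * N) * real_of_int q powr (- lam)"
    define Q where "Q = real_of_int q"
    have Q: "Q \<ge> 1"
      using that by (simp add: Q_def)
    assume "\<not> ?thesis"
    then have "\<bar>\<theta>\<^sub>1 - real_of_int p1 / Q\<bar> \<le> \<delta>" "\<bar>\<theta>\<^sub>2 - real_of_int p2 / Q\<bar> \<le> \<delta>"
      by (simp_all add: \<delta>_def Q_def)
    moreover have "1 < L'"
      using LL' P \<open>P < L\<close> by (simp add: power2_eq_square)
    ultimately have "1 \<le> 172 * (B + 1) * N * Q * (2 * Q) powr (ln (21.5 * (B + 1) * N) / ln L') * \<delta>"
      using sqrt_pair_approximation[of A \<epsilon> N K Q "real_of_int p1" "real_of_int p2" \<delta>] assms Q big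
      by (auto simp: B_def e_def L'_def Q_def)
    also have "21.5 * (B + 1) * N = 1.075 * P"
      by (simp add: P_def)
    also have "172 * (B + 1) * N * Q * (2 * Q) powr (ln (1.075 * P) / ln L') * \<delta>
        \<le> 172 * (B + 1) * N * Q * (2 * Q powr (lam - 1)) * \<delta>"
    proof (intro mult_right_mono mult_left_mono)
      have "(2 * Q) powr (ln (1.075 * P) / ln L') \<le> (2 * Q) powr (lam - 1)"
        using ratio Q by (intro powr_mono) auto
      also have "\<dots> = 2 powr (lam - 1) * Q powr (lam - 1)"
        using Q by (simp add: powr_mult)
      also have "2 powr (lam - 1) \<le> (2::real) powr 1"
        using \<open>lam < 2\<close> by (intro powr_mono) auto
      finally show "(2 * Q) powr (ln (1.075 * P) / ln L') \<le> 2 * Q powr (lam - 1)"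
        using Q by (simp add: mult_right_mono)
    qed (use B N Q in \<open>auto simp: \<delta>_def\<close>)
    \<comment> \<open>The bound 2^(\<lambda> - 1) \<le> 2 has doubled 172. All powers of q and the
      factor (B + 1) N cancel against \<open>\<delta>\<close>, leaving the absurd 1 \<le> 344 /
      (2.838 * 10^28).\<close>
    also have "\<dots> = 344 * ((B + 1) * N * inverse ((B + 1) * N)) * (Q * Q powr (lam - 1) * Q powr - lam) / (2.838 * 10 ^ 28)"
    proof -
      have "inverse (c * (B + 1) * N) = inverse ((B + 1) * N) / c" for c
        by (simp add: mult.assoc divide_inverse)
      moreover have "172 * b * n * Q * (2 * Y) * (i / c * Z) = 344 * (b * n * i) * (Q * Y * Z) / c"
        for b n i c Y Z :: real
        by simp
      ultimately show ?thesis
        unfolding \<delta>_def Q_def[symmetric] by (simp only:)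
    qed
    also have "(B + 1) * N * inverse ((B + 1) * N) = 1"
      using B N by (intro right_inverse) simp
    also have "Q * Q powr (lam - 1) * Q powr - lam = 1"
      using Q by (simp add: powr_diff powr_minus)
    finally show False
      by simp
  qed
  then show ?thesis
    using \<open>lam < 2\<close> by (simp add: B_def)
qed

end
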